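(* Let $(M,F,g)$ be an $(\alpha,\varepsilon)$-metric manifold with $\alpha=+1$, and let $\phi(\cdot,\cdot)=g(F\cdot,\cdot)$ be its fundamental tensor. On $\mathbb TM=TM\oplus T^*M$ put, for $b\in\{g,\phi\}$ and $\lambda\in\{+1,-1\}$, $$\mathcal J_b=\begin{pmatrix}0&-\sharp_b\\ \flat_b&0\end{pmatrix},\quad \mathcal F_b=\begin{pmatrix}0&\sharp_b\\ \flat_b&0\end{pmatrix},\quad \mathcal F_{\lambda,F}=\begin{pmatrix}F&0\\0&\lambda F^*\end{pmatrix}.$$ Then the following are generalized triple structures: $(\mathcal F_g,\mathcal F_{\varepsilon,F},\mathcal F_\phi)$ is a generalized almost hyperproduct structure; $(\mathcal F_g,\mathcal F_{-\varepsilon,F},\mathcal J_\phi)$ is a generalized almost biparacomplex structure; $(\mathcal F_\phi,\mathcal F_{-\varepsilon,F},\mathcal J_g)$ is a generalized almost biparacomplex structure; and $(\mathcal J_g,\mathcal J_\phi,-\mathcal F_{\varepsilon,F})$ is a generalized almost bicomplex structure.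
   Context: An $(\alpha,\varepsilon)$-metric manifold $(M,F,g)$, $\alpha,\varepsilon\in\{+1,-1\}$, is a smooth manifold with a Riemannian or pseudo-Riemannian metric $g$ and an $\mathfrak F(M)$-linear $F\colon\mathfrak X(M)\to\mathfrak X(M)$ with $F^2=\alpha Id$ and $g(FX,FY)=\varepsilon g(X,Y)$ for all $X,Y$. $\mathfrak F(M)$, $\mathfrak X(M)$, $\Lambda^1(M)$ denote smooth functions, vector fields, 1-forms; sections of $\mathbb TM$ are written $X+\xi$. For a nondegenerate bilinear form $b$ on $M$: $(\flat_bX)(Y)=b(X,Y)$, $\sharp_b=\flat_b^{-1}$. $(F^*\xi)(X)=\xi(FX)$. Matrix notation: $\begin{pmatrix}H&\sigma\\ \tau&K\end{pmatrix}(X+\xi)=(HX+\sigma\xi)+(\tau X+K\xi)$. A generalized triple structure $(\mathcal A,\mathcal B,\mathcal C)$ consists of $\mathfrak F(M)$-linear endomorphisms of $\Gamma(\mathbb TM)$, each with square $Id$ (almost product) or $-Id$ (almost complex), such that $\mathcal B\mathcal A=\pm\mathcal A\mathcal B$ and $\mathcal C=\mathcal A\mathcal B$. It is generalized almost hyperproduct if $\mathcal A^2=\mathcal B^2=\mathcal C^2=Id$ and the three pairwise commute; generalized almost bicomplex if $\mathcal A^2=\mathcal B^2=-Id$, $\mathcal C^2=Id$ and the three pairwise commute; generalized almost biparacomplex if $\mathcal A^2=\mathcal B^2=Id$, $\mathcal C^2=-Id$ and the three pairwise anti-commute. *)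

theory Defs
  imports "HOL-Analysis.Analysis" "HOL-Library.Function_Algebras" "HOL-Library.Product_Plus"
begin

text \<open>
  Conventions. A manifold is given by a topology \<open>M\<close> and an atlas \<open>A\<close> with values in a Euclidean
  space; smoothness of functions depends only on the smooth structure generated by \<open>A\<close>, so \<open>A\<close> is
  not required to be maximal. Vector fields are the derivations of the algebra of smooth functions,
  and 1-forms, like all other tensor fields, are multilinear over smooth functions (the definitions
  used e.g. in Helgason's \<^emph>\<open>Differential Geometry, Lie Groups, and Symmetric Spaces\<close>).
  All these objects are total functions in HOL; they are normalised to be \<open>0\<close> off their domain,
  so that equality is the intended one and the pointwise operations of function types
  (\<open>+\<close>, \<open>-\<close>, \<open>*\<close>, \<open>0\<close>) are the operations of the ring of smooth functions and its modules.
\<close>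

type_synonym ('a, 'e) chart = "'a set \<times> ('a \<Rightarrow> 'e)"
type_synonym 'a sfun = "'a \<Rightarrow> real"
type_synonym 'a vfield = "'a sfun \<Rightarrow> 'a sfun"
type_synonym 'a oneform = "'a vfield \<Rightarrow> 'a sfun"
type_synonym 'a gsection = "'a vfield \<times> 'a oneform"


section \<open>Smooth manifolds\<close>

text \<open>Only meant for open \<open>S\<close>.\<close>

primrec Ck_on :: "nat \<Rightarrow> 'e::real_normed_vector set \<Rightarrow> ('e \<Rightarrow> 'f::real_normed_vector) \<Rightarrow> bool" where
  "Ck_on 0 S f \<longleftrightarrow> continuous_on S f"
| "Ck_on (Suc k) S f \<longleftrightarrow>
     (\<forall>x\<in>S. f differentiable (at x)) \<and> (\<forall>v. Ck_on k S (\<lambda>x. frechet_derivative f (at x) v))"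

definition smooth_on :: "'e::real_normed_vector set \<Rightarrow> ('e \<Rightarrow> 'f::real_normed_vector) \<Rightarrow> bool" where
  "smooth_on S f \<longleftrightarrow> (\<forall>k. Ck_on k S f)"

definition chart_on :: "'a topology \<Rightarrow> ('a, 'e::euclidean_space) chart \<Rightarrow> bool" where
  "chart_on M = (\<lambda>(U, c). openin M U \<and> open (c ` U) \<and>
     homeomorphic_map (subtopology M U) (top_of_set (c ` U)) c)"

definition smooth_manifold :: "'a topology \<Rightarrow> ('a, 'e::euclidean_space) chart set \<Rightarrow> bool" where
  "smooth_manifold M A \<longleftrightarrow>
     Hausdorff_space M \<and> second_countable M \<and>
     (\<forall>\<kappa>\<in>A. chart_on M \<kappa>) \<and> (\<Union>(U, c)\<in>A. U) = topspace M \<and>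
     (\<forall>(U, c)\<in>A. \<forall>(V, d)\<in>A. smooth_on (c ` (U \<inter> V)) (d \<circ> inv_into U c))"


section \<open>Functions, vector fields, 1-forms and tensors\<close>

definition smooth_functions :: "'a topology \<Rightarrow> ('a, 'e::euclidean_space) chart set \<Rightarrow> 'a sfun set" where
  "smooth_functions M A =
     {f. (\<forall>p. p \<notin> topspace M \<longrightarrow> f p = 0) \<and>
         (\<forall>(U, c)\<in>A. smooth_on (c ` U) (f \<circ> inv_into U c))}"

text \<open>Multiplication of a vector field or a 1-form by a function; a real scalar \<open>a\<close> acts as the
  constant function \<open>\<lambda>_. a\<close>.\<close>

definition fmult :: "'a sfun \<Rightarrow> ('b \<Rightarrow> 'a sfun) \<Rightarrow> ('b \<Rightarrow> 'a sfun)" (infixr "\<cdot>\<^sub>F" 75) where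
  "f \<cdot>\<^sub>F T = (\<lambda>x. f * T x)"

definition vector_fields :: "'a topology \<Rightarrow> ('a, 'e::euclidean_space) chart set \<Rightarrow> 'a vfield set" where
  "vector_fields M A =
     {X. (\<forall>f. f \<notin> smooth_functions M A \<longrightarrow> X f = 0) \<and>
         (\<forall>f\<in>smooth_functions M A. X f \<in> smooth_functions M A) \<and>
         (\<forall>f\<in>smooth_functions M A. \<forall>h\<in>smooth_functions M A. X (f + h) = X f + X h) \<and>
         (\<forall>f\<in>smooth_functions M A. \<forall>a::real. X ((\<lambda>_. a) * f) = (\<lambda>_. a) * X f) \<and>
         (\<forall>f\<in>smooth_functions M A. \<forall>h\<in>smooth_functions M A. X (f * h) = X f * h + f * X h)}"

definition one_forms :: "'a topology \<Rightarrow> ('a, 'e::euclidean_space) chart set \<Rightarrow> 'a oneform set" where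
  "one_forms M A =
     {\<xi>. (\<forall>X. X \<notin> vector_fields M A \<longrightarrow> \<xi> X = 0) \<and>
         (\<forall>X\<in>vector_fields M A. \<xi> X \<in> smooth_functions M A) \<and>
         (\<forall>X\<in>vector_fields M A. \<forall>Y\<in>vector_fields M A. \<xi> (X + Y) = \<xi> X + \<xi> Y) \<and>
         (\<forall>f\<in>smooth_functions M A. \<forall>X\<in>vector_fields M A. \<xi> (f \<cdot>\<^sub>F X) = f * \<xi> X)}"

definition bilinear_form ::
  "'a topology \<Rightarrow> ('a, 'e::euclidean_space) chart set \<Rightarrow> ('a vfield \<Rightarrow> 'a vfield \<Rightarrow> 'a sfun) \<Rightarrow> bool" where
  "bilinear_form M A b \<longleftrightarrow>
     (\<forall>X\<in>vector_fields M A. \<forall>Y\<in>vector_fields M A. b X Y \<in> smooth_functions M A) \<and>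
     (\<forall>X\<in>vector_fields M A. \<forall>Y\<in>vector_fields M A. \<forall>Z\<in>vector_fields M A.
        b (X + Y) Z = b X Z + b Y Z \<and> b X (Y + Z) = b X Y + b X Z) \<and>
     (\<forall>f\<in>smooth_functions M A. \<forall>X\<in>vector_fields M A. \<forall>Y\<in>vector_fields M A.
        b (f \<cdot>\<^sub>F X) Y = f * b X Y \<and> b X (f \<cdot>\<^sub>F Y) = f * b X Y)"

text \<open>Nondegeneracy of the form induced on each tangent space: tangent vectors at \<open>p\<close> are the
  values at \<open>p\<close> of vector fields, and the value of \<open>X\<close> at \<open>p\<close> is the functional \<open>\<lambda>f. X f p\<close>.\<close>

definition nondegenerate ::
  "'a topology \<Rightarrow> ('a, 'e::euclidean_space) chart set \<Rightarrow> ('a vfield \<Rightarrow> 'a vfield \<Rightarrow> 'a sfun) \<Rightarrow> bool" where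
  "nondegenerate M A b \<longleftrightarrow>
     (\<forall>p\<in>topspace M. \<forall>X\<in>vector_fields M A.
        (\<forall>Y\<in>vector_fields M A. b X Y p = 0) \<longrightarrow> (\<forall>f\<in>smooth_functions M A. X f p = 0))"

text \<open>This covers the Riemannian (positive definite) metrics. Some authors require in addition that
  the index be constant, which is automatic on connected manifolds.\<close>

definition pseudo_riemannian_metric ::
  "'a topology \<Rightarrow> ('a, 'e::euclidean_space) chart set \<Rightarrow> ('a vfield \<Rightarrow> 'a vfield \<Rightarrow> 'a sfun) \<Rightarrow> bool" where
  "pseudo_riemannian_metric M A g \<longleftrightarrow>
     bilinear_form M A g \<and>
     (\<forall>X\<in>vector_fields M A. \<forall>Y\<in>vector_fields M A. g X Y = g Y X) \<and>
     nondegenerate M A g"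

definition vfield_endomorphism ::
  "'a topology \<Rightarrow> ('a, 'e::euclidean_space) chart set \<Rightarrow> ('a vfield \<Rightarrow> 'a vfield) \<Rightarrow> bool" where
  "vfield_endomorphism M A F \<longleftrightarrow>
     (\<forall>X\<in>vector_fields M A. F X \<in> vector_fields M A) \<and>
     (\<forall>X\<in>vector_fields M A. \<forall>Y\<in>vector_fields M A. F (X + Y) = F X + F Y) \<and>
     (\<forall>f\<in>smooth_functions M A. \<forall>X\<in>vector_fields M A. F (f \<cdot>\<^sub>F X) = f \<cdot>\<^sub>F F X)"

definition metric_manifold ::
  "real \<Rightarrow> real \<Rightarrow> 'a topology \<Rightarrow> ('a, 'e::euclidean_space) chart set \<Rightarrow>
   ('a vfield \<Rightarrow> 'a vfield) \<Rightarrow> ('a vfield \<Rightarrow> 'a vfield \<Rightarrow> 'a sfun) \<Rightarrow> bool" where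
  "metric_manifold \<alpha> \<epsilon> M A F g \<longleftrightarrow>
     \<alpha> \<in> {1, -1} \<and> \<epsilon> \<in> {1, -1} \<and>
     smooth_manifold M A \<and> pseudo_riemannian_metric M A g \<and> vfield_endomorphism M A F \<and>
     (\<forall>X\<in>vector_fields M A. F (F X) = (\<lambda>_. \<alpha>) \<cdot>\<^sub>F X) \<and>
     (\<forall>X\<in>vector_fields M A. \<forall>Y\<in>vector_fields M A. g (F X) (F Y) = (\<lambda>_. \<epsilon>) * g X Y)"

definition fundamental_tensor ::
  "('a vfield \<Rightarrow> 'a vfield) \<Rightarrow> ('a vfield \<Rightarrow> 'a vfield \<Rightarrow> 'a sfun) \<Rightarrow> 'a vfield \<Rightarrow> 'a vfield \<Rightarrow> 'a sfun" where
  "fundamental_tensor F g = (\<lambda>X Y. g (F X) Y)"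

definition flat ::
  "'a topology \<Rightarrow> ('a, 'e::euclidean_space) chart set \<Rightarrow> ('a vfield \<Rightarrow> 'a vfield \<Rightarrow> 'a sfun) \<Rightarrow>
   'a vfield \<Rightarrow> 'a oneform" where
  "flat M A b X = (\<lambda>Y. if Y \<in> vector_fields M A then b X Y else 0)"

definition sharp ::
  "'a topology \<Rightarrow> ('a, 'e::euclidean_space) chart set \<Rightarrow> ('a vfield \<Rightarrow> 'a vfield \<Rightarrow> 'a sfun) \<Rightarrow>
   'a oneform \<Rightarrow> 'a vfield" where
  "sharp M A b = inv_into (vector_fields M A) (flat M A b)"

definition dual_map ::
  "'a topology \<Rightarrow> ('a, 'e::euclidean_space) chart set \<Rightarrow> ('a vfield \<Rightarrow> 'a vfield) \<Rightarrow>
   'a oneform \<Rightarrow> 'a oneform" where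
  "dual_map M A F \<xi> = (\<lambda>X. if X \<in> vector_fields M A then \<xi> (F X) else 0)"


section \<open>The generalized tangent bundle\<close>

text \<open>The section written \<open>X + \<xi>\<close> on paper is the pair \<open>(X, \<xi>)\<close>.\<close>

definition gsections :: "'a topology \<Rightarrow> ('a, 'e::euclidean_space) chart set \<Rightarrow> 'a gsection set" where
  "gsections M A = vector_fields M A \<times> one_forms M A"

definition block ::
  "('a vfield \<Rightarrow> 'a vfield) \<Rightarrow> ('a oneform \<Rightarrow> 'a vfield) \<Rightarrow>
   ('a vfield \<Rightarrow> 'a oneform) \<Rightarrow> ('a oneform \<Rightarrow> 'a oneform) \<Rightarrow> 'a gsection \<Rightarrow> 'a gsection" where
  "block H \<sigma> \<tau> K = (\<lambda>(X, \<xi>). (H X + \<sigma> \<xi>, \<tau> X + K \<xi>))"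

definition gen_J ::
  "'a topology \<Rightarrow> ('a, 'e::euclidean_space) chart set \<Rightarrow> ('a vfield \<Rightarrow> 'a vfield \<Rightarrow> 'a sfun) \<Rightarrow>
   'a gsection \<Rightarrow> 'a gsection" where
  "gen_J M A b = block 0 (- sharp M A b) (flat M A b) 0"

definition gen_F ::
  "'a topology \<Rightarrow> ('a, 'e::euclidean_space) chart set \<Rightarrow> ('a vfield \<Rightarrow> 'a vfield \<Rightarrow> 'a sfun) \<Rightarrow>
   'a gsection \<Rightarrow> 'a gsection" where
  "gen_F M A b = block 0 (sharp M A b) (flat M A b) 0"

definition gen_diag ::
  "'a topology \<Rightarrow> ('a, 'e::euclidean_space) chart set \<Rightarrow> real \<Rightarrow> ('a vfield \<Rightarrow> 'a vfield) \<Rightarrow>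
   'a gsection \<Rightarrow> 'a gsection" where
  "gen_diag M A l F = block F 0 0 (\<lambda>\<xi>. (\<lambda>_. l) \<cdot>\<^sub>F dual_map M A F \<xi>)"

definition gen_endomorphism ::
  "'a topology \<Rightarrow> ('a, 'e::euclidean_space) chart set \<Rightarrow> ('a gsection \<Rightarrow> 'a gsection) \<Rightarrow> bool" where
  "gen_endomorphism M A T \<longleftrightarrow>
     (\<forall>s\<in>gsections M A. T s \<in> gsections M A) \<and>
     (\<forall>s\<in>gsections M A. \<forall>t\<in>gsections M A. T (s + t) = T s + T t) \<and>
     (\<forall>f\<in>smooth_functions M A. \<forall>s\<in>gsections M A.
        T (f \<cdot>\<^sub>F fst s, f \<cdot>\<^sub>F snd s) = (f \<cdot>\<^sub>F fst (T s), f \<cdot>\<^sub>F snd (T s)))"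

text \<open>Equality of endomorphisms of the module of sections.\<close>

definition gen_eq ::
  "'a topology \<Rightarrow> ('a, 'e::euclidean_space) chart set \<Rightarrow>
   ('a gsection \<Rightarrow> 'a gsection) \<Rightarrow> ('a gsection \<Rightarrow> 'a gsection) \<Rightarrow> bool" where
  "gen_eq M A S T \<longleftrightarrow> (\<forall>s\<in>gsections M A. S s = T s)"

definition generalized_triple_structure ::
  "'a topology \<Rightarrow> ('a, 'e::euclidean_space) chart set \<Rightarrow> ('a gsection \<Rightarrow> 'a gsection) \<Rightarrow>
   ('a gsection \<Rightarrow> 'a gsection) \<Rightarrow> ('a gsection \<Rightarrow> 'a gsection) \<Rightarrow> bool" where
  "generalized_triple_structure M A P Q R \<longleftrightarrow>
     (\<forall>T\<in>{P, Q, R}. gen_endomorphism M A T \<and>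
        (gen_eq M A (T \<circ> T) id \<or> gen_eq M A (T \<circ> T) (- id))) \<and>
     (gen_eq M A (Q \<circ> P) (P \<circ> Q) \<or> gen_eq M A (Q \<circ> P) (- (P \<circ> Q))) \<and>
     gen_eq M A R (P \<circ> Q)"

definition pairwise_commute ::
  "'a topology \<Rightarrow> ('a, 'e::euclidean_space) chart set \<Rightarrow> ('a gsection \<Rightarrow> 'a gsection) \<Rightarrow>
   ('a gsection \<Rightarrow> 'a gsection) \<Rightarrow> ('a gsection \<Rightarrow> 'a gsection) \<Rightarrow> bool" where
  "pairwise_commute M A P Q R \<longleftrightarrow>
     gen_eq M A (P \<circ> Q) (Q \<circ> P) \<and> gen_eq M A (Q \<circ> R) (R \<circ> Q) \<and> gen_eq M A (P \<circ> R) (R \<circ> P)"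

definition pairwise_anticommute ::
  "'a topology \<Rightarrow> ('a, 'e::euclidean_space) chart set \<Rightarrow> ('a gsection \<Rightarrow> 'a gsection) \<Rightarrow>
   ('a gsection \<Rightarrow> 'a gsection) \<Rightarrow> ('a gsection \<Rightarrow> 'a gsection) \<Rightarrow> bool" where
  "pairwise_anticommute M A P Q R \<longleftrightarrow>
     gen_eq M A (P \<circ> Q) (- (Q \<circ> P)) \<and> gen_eq M A (Q \<circ> R) (- (R \<circ> Q)) \<and>
     gen_eq M A (P \<circ> R) (- (R \<circ> P))"

definition generalized_almost_hyperproduct ::
  "'a topology \<Rightarrow> ('a, 'e::euclidean_space) chart set \<Rightarrow> ('a gsection \<Rightarrow> 'a gsection) \<Rightarrow>
   ('a gsection \<Rightarrow> 'a gsection) \<Rightarrow> ('a gsection \<Rightarrow> 'a gsection) \<Rightarrow> bool" where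
  "generalized_almost_hyperproduct M A P Q R \<longleftrightarrow>
     generalized_triple_structure M A P Q R \<and>
     gen_eq M A (P \<circ> P) id \<and> gen_eq M A (Q \<circ> Q) id \<and> gen_eq M A (R \<circ> R) id \<and>
     pairwise_commute M A P Q R"

definition generalized_almost_bicomplex ::
  "'a topology \<Rightarrow> ('a, 'e::euclidean_space) chart set \<Rightarrow> ('a gsection \<Rightarrow> 'a gsection) \<Rightarrow>
   ('a gsection \<Rightarrow> 'a gsection) \<Rightarrow> ('a gsection \<Rightarrow> 'a gsection) \<Rightarrow> bool" where
  "generalized_almost_bicomplex M A P Q R \<longleftrightarrow>
     generalized_triple_structure M A P Q R \<and>
     gen_eq M A (P \<circ> P) (- id) \<and> gen_eq M A (Q \<circ> Q) (- id) \<and> gen_eq M A (R \<circ> R) id \<and>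
     pairwise_commute M A P Q R"

definition generalized_almost_biparacomplex ::
  "'a topology \<Rightarrow> ('a, 'e::euclidean_space) chart set \<Rightarrow> ('a gsection \<Rightarrow> 'a gsection) \<Rightarrow>
   ('a gsection \<Rightarrow> 'a gsection) \<Rightarrow> ('a gsection \<Rightarrow> 'a gsection) \<Rightarrow> bool" where
  "generalized_almost_biparacomplex M A P Q R \<longleftrightarrow>
     generalized_triple_structure M A P Q R \<and>
     gen_eq M A (P \<circ> P) id \<and> gen_eq M A (Q \<circ> Q) id \<and> gen_eq M A (R \<circ> R) (- id) \<and>
     pairwise_anticommute M A P Q R"

end

theory Submission
  imports Defs "Jordan_Normal_Form.Determinant"
begin

text \<open>
  The heart of the matter is that \<open>\<flat>\<^sub>g\<close> maps derivations \<^emph>\<open>onto\<close> the forms that are linear over smooth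
  functions. By Hadamard's lemma a derivation is, near a point, a combination of the coordinate fields
  of a chart (cut off by a bump function), so a linear form and \<open>g\<close> are determined there by their
  values on these fields. Nondegeneracy makes the Gram determinant nonzero at the point, and Cramer's
  rule over the ring of functions smooth at the point solves \<open>g(X, \<cdot>) = \<xi>\<close> locally; the solutions are
  unique, hence glue. This applies to any nondegenerate bilinear form, in particular to \<open>g\<close> and \<open>\<phi>\<close>.
  Since \<open>\<sharp>\<^sub>\<phi> = F \<sharp>\<^sub>g\<close>, \<open>\<flat>\<^sub>\<phi> = \<flat>\<^sub>g F\<close> and \<open>\<epsilon> F* = \<flat>\<^sub>g F \<sharp>\<^sub>g\<close>, all the operators are words in \<open>F\<close>, \<open>\<flat>\<^sub>g\<close>, \<open>\<sharp>\<^sub>g\<close>,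
  so each third operator is the product of the first two, which are (anti-)commuting square roots of
  \<open>\<plusminus> Id\<close>.
\<close>

no_notation scalar_prod (infix "\<bullet>" 70)

section \<open>Calculus of smooth maps\<close>

lemma linear_eq_sum_Basis:
  fixes L :: "'e::euclidean_space \<Rightarrow> 'f::real_vector"
  assumes "linear L"
  shows "L v = (\<Sum>b\<in>Basis. (v \<bullet> b) *\<^sub>R L b)"
proof -
  have "L v = L (\<Sum>b\<in>Basis. (v \<bullet> b) *\<^sub>R b)" by (simp add: euclidean_representation)
  also have "\<dots> = (\<Sum>b\<in>Basis. (v \<bullet> b) *\<^sub>R L b)"
    by (simp only: linear_sum[OF assms] linear_scale[OF assms])
  finally show ?thesis .
qed

lemma Ck_on_cong:
  assumes "open S" "\<And>x. x \<in> S \<Longrightarrow> f x = g x" "Ck_on k S f"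
  shows "Ck_on k S g"
  using assms(2,3)
proof (induction k arbitrary: f g)
  case 0
  then show ?case using continuous_on_cong by (metis Ck_on.simps(1))
next
  case (Suc k)
  have f: "f differentiable at x" if "x \<in> S" for x
    using Suc.prems(2) that by simp
  show ?case
    unfolding Ck_on.simps
  proof (intro conjI ballI allI)
    show "g differentiable at x" if "x \<in> S" for x
    proof (rule differentiableI)
      show "(g has_derivative frechet_derivative f (at x)) (at x)"
        by (rule has_derivative_transform_within_open[OF _ assms(1) that Suc.prems(1)])
          (use f[OF that] in \<open>simp_all add: frechet_derivative_works[symmetric]\<close>)
    qed
    have "frechet_derivative f (at x) v = frechet_derivative g (at x) v" if "x \<in> S" for x v
      using frechet_derivative_transform_within_open[OF f[OF that] assms(1) that Suc.prems(1)] by simp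
    moreover have "Ck_on k S (\<lambda>x. frechet_derivative f (at x) v)" for v
      using Suc.prems(2) by simp
    ultimately show "Ck_on k S (\<lambda>x. frechet_derivative g (at x) v)" for v
      by (rule Suc.IH)
  qed
qed

lemma Ck_on_SucI:
  assumes "open S" "\<And>x. x \<in> S \<Longrightarrow> (f has_derivative f' x) (at x)"
    and "\<And>v. Ck_on k S (\<lambda>x. f' x v)"
  shows "Ck_on (Suc k) S f"
  unfolding Ck_on.simps
proof (intro conjI ballI allI)
  show "f differentiable at x" if "x \<in> S" for x
    using assms(2)[OF that] by (rule differentiableI)
  show "Ck_on k S (\<lambda>x. frechet_derivative f (at x) v)" for v
    by (rule Ck_on_cong[OF assms(1) _ assms(3)[of v]]) (use frechet_derivative_at[OF assms(2)] in simp)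
qed

lemma Ck_on_Suc_has_derivative:
  assumes "Ck_on (Suc k) S f" "x \<in> S"
  shows "(f has_derivative frechet_derivative f (at x)) (at x)"
  using assms by (simp add: frechet_derivative_works[symmetric])

lemma Ck_on_Suc_imp_Ck_on: "Ck_on (Suc k) S f \<Longrightarrow> Ck_on k S f"
proof (induction k arbitrary: f)
  case 0
  then show ?case
    by (auto intro!: continuous_at_imp_continuous_on differentiable_imp_continuous_within)
next
  case (Suc k)
  from Suc.prems show ?case
    unfolding Ck_on.simps(2)[of "Suc k"] Ck_on.simps(2)[of k S f] using Suc.IH by blast
qed

lemma Ck_on_imp_continuous_on: "Ck_on k S f \<Longrightarrow> continuous_on S f"
  by (induction k) (use Ck_on_Suc_imp_Ck_on in \<open>auto simp del: Ck_on.simps(2)\<close>)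

lemma Ck_on_subset: "Ck_on k S f \<Longrightarrow> T \<subseteq> S \<Longrightarrow> Ck_on k T f"
  by (induction k arbitrary: f) (auto intro: continuous_on_subset)

lemma Ck_on_locally:
  assumes "\<And>x. x \<in> S \<Longrightarrow> \<exists>T. open T \<and> x \<in> T \<and> Ck_on k T f"
  shows "Ck_on k S f"
  using assms
proof (induction k arbitrary: f)
  case 0
  have "isCont f x" if "x \<in> S" for x
  proof -
    obtain T where "open T" "x \<in> T" "continuous_on T f" using 0[OF \<open>x \<in> S\<close>] by auto
    then show ?thesis by (simp add: continuous_on_eq_continuous_at)
  qed
  then show ?case
    unfolding Ck_on.simps by (intro continuous_at_imp_continuous_on ballI)
next
  case (Suc k)
  show ?case
    unfolding Ck_on.simps
  proof (intro conjI ballI allI)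
    show "f differentiable at x" if "x \<in> S" for x
      using Suc.prems[OF that] by auto
    show "Ck_on k S (\<lambda>x. frechet_derivative f (at x) v)" for v
      using Suc.prems by (intro Suc.IH) force
  qed
qed

lemma Ck_on_const: "open S \<Longrightarrow> Ck_on k S (\<lambda>_. c)"
proof (induction k arbitrary: c)
  case (Suc k)
  then show ?case by (intro Ck_on_SucI[where f' = "\<lambda>_ _. 0"]) auto
qed simp

lemma Ck_on_bounded_linear:
  assumes "open S" "bounded_linear L"
  shows "Ck_on k S L"
proof (cases k)
  case 0
  then show ?thesis using bounded_linear.continuous_on[OF assms(2) continuous_on_id] by simp
next
  case (Suc m)
  have "Ck_on (Suc m) S L"
    by (rule Ck_on_SucI[OF assms(1) bounded_linear_imp_has_derivative[OF assms(2)]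
          Ck_on_const[OF assms(1)]])
  with Suc show ?thesis by simp
qed

lemma Ck_on_add:
  assumes "open S" "Ck_on k S f" "Ck_on k S g"
  shows "Ck_on k S (\<lambda>x. f x + g x)"
  using assms(2,3)
proof (induction k arbitrary: f g)
  case 0
  then show ?case by (simp add: continuous_on_add)
next
  case (Suc k)
  show ?case
  proof (rule Ck_on_SucI[OF assms(1)])
    show "((\<lambda>x. f x + g x) has_derivative
        (\<lambda>v. frechet_derivative f (at x) v + frechet_derivative g (at x) v)) (at x)" if "x \<in> S" for x
      using Suc.prems that by (intro has_derivative_add Ck_on_Suc_has_derivative)
    show "Ck_on k S (\<lambda>x. frechet_derivative f (at x) v + frechet_derivative g (at x) v)" for v
      using Suc by simp
  qed
qed

lemma Ck_on_sum:
  assumes "open S" "\<And>i. i \<in> I \<Longrightarrow> Ck_on k S (f i)"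
  shows "Ck_on k S (\<lambda>x. \<Sum>i\<in>I. f i x)"
  using assms(2)
  by (induction I rule: infinite_finite_induct) (auto intro: Ck_on_add Ck_on_const assms(1))

lemma (in bounded_bilinear) Ck_on:
  assumes "open S" "Ck_on k S f" "Ck_on k S g"
  shows "Ck_on k S (\<lambda>x. prod (f x) (g x))"
  using assms(2,3)
proof (induction k arbitrary: f g)
  case 0
  then show ?case using continuous_on[of S f g] by simp
next
  case (Suc k)
  let ?f' = "\<lambda>x. frechet_derivative f (at x)" and ?g' = "\<lambda>x. frechet_derivative g (at x)"
  show ?case
  proof (rule Ck_on_SucI[OF assms(1)])
    show "((\<lambda>x. prod (f x) (g x)) has_derivative (\<lambda>v. prod (f x) (?g' x v) + prod (?f' x v) (g x))) (at x)"
      if "x \<in> S" for x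
      using Suc.prems that by (intro FDERIV Ck_on_Suc_has_derivative)
    show "Ck_on k S (\<lambda>x. prod (f x) (?g' x v) + prod (?f' x v) (g x))" for v
      using Suc.prems Ck_on_Suc_imp_Ck_on[OF Suc.prems(1)] Ck_on_Suc_imp_Ck_on[OF Suc.prems(2)]
      by (intro Ck_on_add Suc.IH assms(1)) auto
  qed
qed

lemmas Ck_on_mult = bounded_bilinear.Ck_on[OF bounded_bilinear_mult]
lemmas Ck_on_scaleR = bounded_bilinear.Ck_on[OF bounded_bilinear_scaleR]
lemmas Ck_on_inner = bounded_bilinear.Ck_on[OF bounded_bilinear_inner]

lemma Ck_on_compose:
  fixes f :: "'e::euclidean_space \<Rightarrow> 'f::real_normed_vector" and g :: "'d::real_normed_vector \<Rightarrow> 'e"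
  assumes "open S" "open T" "g ` S \<subseteq> T" "Ck_on k T f" "Ck_on k S g"
  shows "Ck_on k S (\<lambda>x. f (g x))"
  using assms(4,5)
proof (induction k arbitrary: f)
  case 0
  then show ?case
    using continuous_on_compose2[of T f S g] assms(3) by simp
next
  case (Suc k)
  let ?f' = "\<lambda>x. frechet_derivative f (at x)" and ?g' = "\<lambda>x. frechet_derivative g (at x)"
  have f': "(f has_derivative ?f' (g x)) (at (g x))" if "x \<in> S" for x
    by (rule Ck_on_Suc_has_derivative[OF Suc.prems(1)]) (use that assms(3) in blast)
  show ?case
  proof (rule Ck_on_SucI[OF assms(1)])
    fix x assume x: "x \<in> S"
    have "((\<lambda>x. f (g x)) has_derivative (\<lambda>v. ?f' (g x) (?g' x v))) (at x)"
      by (rule has_derivative_compose[OF Ck_on_Suc_has_derivative[OF Suc.prems(2) x] f'[OF x]])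
    then show "((\<lambda>x. f (g x)) has_derivative (\<lambda>v. \<Sum>b\<in>Basis. (?g' x v \<bullet> b) *\<^sub>R ?f' (g x) b)) (at x)"
      by (simp only: linear_eq_sum_Basis[OF has_derivative_linear[OF f'[OF x]], symmetric])
  next
    show "Ck_on k S (\<lambda>x. \<Sum>b\<in>Basis. (?g' x v \<bullet> b) *\<^sub>R ?f' (g x) b)" for v
      using Suc.prems Ck_on_Suc_imp_Ck_on[OF Suc.prems(2)]
      by (intro Ck_on_sum Ck_on_scaleR Ck_on_inner Ck_on_const Suc.IH assms(1)) simp_all
  qed
qed

lemma Ck_on_inverse:
  fixes f :: "'e::real_normed_vector \<Rightarrow> 'f::real_normed_div_algebra"
  assumes "open S" "\<And>x. x \<in> S \<Longrightarrow> f x \<noteq> 0" "Ck_on k S f"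
  shows "Ck_on k S (\<lambda>x. inverse (f x))"
  using assms(3)
proof (induction k)
  case 0
  then show ?case using assms(2) by (simp add: continuous_on_inverse)
next
  case (Suc k)
  let ?f' = "\<lambda>x. frechet_derivative f (at x)"
  show ?case
  proof (rule Ck_on_SucI[OF assms(1)])
    show "((\<lambda>x. inverse (f x)) has_derivative (\<lambda>v. - 1 * (inverse (f x) * ?f' x v * inverse (f x)))) (at x)"
      if "x \<in> S" for x
      using Deriv.has_derivative_inverse[OF assms(2)[OF that] Ck_on_Suc_has_derivative[OF Suc.prems that]]
      by simp
    show "Ck_on k S (\<lambda>x. - 1 * (inverse (f x) * ?f' x v * inverse (f x)))" for v
      using Suc.prems Suc.IH[OF Ck_on_Suc_imp_Ck_on[OF Suc.prems]]
      by (intro Ck_on_mult assms(1) Ck_on_const) auto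
  qed
qed

lemma smooth_on_cong:
  assumes "open S" "\<And>x. x \<in> S \<Longrightarrow> f x = g x" "smooth_on S f"
  shows "smooth_on S g"
  using assms(3) Ck_on_cong[OF assms(1,2)] by (simp add: smooth_on_def)

lemma smooth_on_subset: "smooth_on S f \<Longrightarrow> T \<subseteq> S \<Longrightarrow> smooth_on T f"
  by (auto simp: smooth_on_def intro: Ck_on_subset)

lemma smooth_on_locally:
  assumes "\<And>x. x \<in> S \<Longrightarrow> \<exists>T. open T \<and> x \<in> T \<and> smooth_on T f"
  shows "smooth_on S f"
  unfolding smooth_on_def
proof (intro allI Ck_on_locally)
  show "\<exists>T. open T \<and> x \<in> T \<and> Ck_on k T f" if "x \<in> S" for k x
    using assms[OF that] by (auto simp: smooth_on_def)
qed

lemma smooth_on_imp_continuous_on: "smooth_on S f \<Longrightarrow> continuous_on S f"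
  by (metis smooth_on_def Ck_on_imp_continuous_on)

lemma smooth_on_has_derivative:
  "smooth_on S f \<Longrightarrow> x \<in> S \<Longrightarrow> (f has_derivative frechet_derivative f (at x)) (at x)"
  by (metis smooth_on_def Ck_on_Suc_has_derivative)

lemma smooth_on_frechet_derivative:
  "smooth_on S f \<Longrightarrow> smooth_on S (\<lambda>x. frechet_derivative f (at x) v)"
  unfolding smooth_on_def by (metis Ck_on.simps(2))

lemma smooth_on_const: "open S \<Longrightarrow> smooth_on S (\<lambda>_. c)"
  by (simp add: smooth_on_def Ck_on_const)

lemma smooth_on_bounded_linear: "open S \<Longrightarrow> bounded_linear L \<Longrightarrow> smooth_on S L"
  by (simp add: smooth_on_def Ck_on_bounded_linear)

lemma smooth_on_add:
  "open S \<Longrightarrow> smooth_on S f \<Longrightarrow> smooth_on S g \<Longrightarrow> smooth_on S (\<lambda>x. f x + g x)"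
  by (simp add: smooth_on_def Ck_on_add)

lemma smooth_on_mult:
  fixes f g :: "'e::real_normed_vector \<Rightarrow> 'f::real_normed_algebra"
  shows "open S \<Longrightarrow> smooth_on S f \<Longrightarrow> smooth_on S g \<Longrightarrow> smooth_on S (\<lambda>x. f x * g x)"
  by (simp add: smooth_on_def Ck_on_mult)

lemma smooth_on_inverse:
  fixes f :: "'e::real_normed_vector \<Rightarrow> 'f::real_normed_div_algebra"
  shows "open S \<Longrightarrow> (\<And>x. x \<in> S \<Longrightarrow> f x \<noteq> 0) \<Longrightarrow> smooth_on S f \<Longrightarrow> smooth_on S (\<lambda>x. inverse (f x))"
  by (simp add: smooth_on_def Ck_on_inverse)

lemma smooth_on_compose:
  fixes f :: "'e::euclidean_space \<Rightarrow> 'f::real_normed_vector" and g :: "'d::real_normed_vector \<Rightarrow> 'e"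
  assumes "open S" "open T" "g ` S \<subseteq> T" "smooth_on T f" "smooth_on S g"
  shows "smooth_on S (\<lambda>x. f (g x))"
  using assms(4,5) by (simp add: smooth_on_def Ck_on_compose[OF assms(1-3)])

subsection \<open>Cutoff functions\<close>

definition exp_inverse :: "nat \<Rightarrow> real \<Rightarrow> real" where
  "exp_inverse n x = (if x > 0 then exp (- inverse x) * inverse x ^ n else 0)"

lemma exp_inverse_over_id_tendsto_0: "((\<lambda>x. exp_inverse n x / x) \<longlongrightarrow> 0) (at 0)"
proof (rule filterlim_split_at)
  show "((\<lambda>x. exp_inverse n x / x) \<longlongrightarrow> 0) (at_left 0)"
    by (rule tendsto_eventually) (simp add: exp_inverse_def eventually_at_filter)
  have "((\<lambda>x. inverse x ^ Suc n / exp (inverse x)) \<longlongrightarrow> (0::real)) (at_right 0)"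
    by (rule filterlim_compose[OF tendsto_power_div_exp_0 filterlim_inverse_at_top_right])
  then show "((\<lambda>x. exp_inverse n x / x) \<longlongrightarrow> 0) (at_right 0)"
    by (rule Lim_transform_eventually)
      (simp add: exp_inverse_def eventually_at_filter exp_minus field_simps)
qed

lemma DERIV_exp_mult_inverse_power:
  fixes x :: real
  assumes "x \<noteq> 0"
  shows "((\<lambda>x. exp (- inverse x) * inverse x ^ n) has_real_derivative
    exp (- inverse x) * inverse x ^ (n + 2) - real n * (exp (- inverse x) * inverse x ^ (n + 1))) (at x)"
proof (rule DERIV_mult[THEN DERIV_cong])
  show "((\<lambda>x. exp (- inverse x)) has_real_derivative exp (- inverse x) * inverse x ^ 2) (at x)"
    using assms by (auto intro!: derivative_eq_intros simp: power2_eq_square)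
  show "((\<lambda>x. inverse x ^ n) has_real_derivative - (real n * inverse x ^ (n + 1))) (at x)"
    by (rule DERIV_power[OF DERIV_inverse, THEN DERIV_cong])
      (use assms in \<open>cases n; simp add: algebra_simps\<close>)+
qed (simp add: power2_eq_square algebra_simps)

lemma DERIV_exp_inverse:
  "(exp_inverse n has_real_derivative exp_inverse (n + 2) x - real n * exp_inverse (n + 1) x) (at x)"
proof -
  consider (pos) "x > 0" | (neg) "x < 0" | (zero) "x = 0" by linarith
  then show ?thesis
  proof cases
    case pos
    then have "(exp_inverse n has_real_derivative
        exp (- inverse x) * inverse x ^ (n + 2) - real n * (exp (- inverse x) * inverse x ^ (n + 1))) (at x)"
      by (intro has_field_derivative_transform_within_open[OF DERIV_exp_mult_inverse_power, where S = "{0<..}"])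
        (auto simp: exp_inverse_def)
    with pos show ?thesis by (simp add: exp_inverse_def)
  next
    case neg
    then have "(exp_inverse n has_real_derivative 0) (at x)"
      by (intro has_field_derivative_transform_within_open[OF DERIV_const, where S = "{..<0}"])
        (auto simp: exp_inverse_def)
    with neg show ?thesis by (simp add: exp_inverse_def)
  next
    case zero
    then show ?thesis
      using exp_inverse_over_id_tendsto_0[of n] by (simp add: DERIV_def exp_inverse_def)
  qed
qed

lemma smooth_on_exp_inverse: "smooth_on UNIV (exp_inverse n)"
proof -
  have "Ck_on k UNIV (exp_inverse n)" for k
  proof (induction k arbitrary: n)
    case 0
    show ?case
      by (auto intro!: continuous_at_imp_continuous_on DERIV_isCont[OF DERIV_exp_inverse])
  next
    case (Suc k)
    show ?case
    proof (rule Ck_on_SucI)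
      show "(exp_inverse n has_derivative
          (\<lambda>v. (exp_inverse (n + 2) x + - real n * exp_inverse (n + 1) x) * v)) (at x)" for x
        using DERIV_exp_inverse[of n x] by (simp add: has_field_derivative_def)
      show "Ck_on k UNIV (\<lambda>x. (exp_inverse (n + 2) x + - real n * exp_inverse (n + 1) x) * v)" for v
        by (intro Ck_on_mult Ck_on_add Suc.IH Ck_on_const open_UNIV)
    qed simp
  qed
  then show ?thesis by (simp add: smooth_on_def)
qed

definition smooth_step :: "real \<Rightarrow> real" where
  "smooth_step x = exp_inverse 0 x * inverse (exp_inverse 0 x + exp_inverse 0 (1 + - 1 * x))"

lemma smooth_step_eq_0: "x \<le> 0 \<Longrightarrow> smooth_step x = 0"
  and smooth_step_eq_1: "x \<ge> 1 \<Longrightarrow> smooth_step x = 1"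
  by (simp_all add: smooth_step_def exp_inverse_def)

lemma smooth_on_smooth_step: "smooth_on UNIV smooth_step"
proof -
  have "exp_inverse 0 x + exp_inverse 0 (1 + - 1 * x) \<noteq> 0" for x
    by (auto simp: exp_inverse_def add_pos_nonneg add_nonneg_pos order_less_imp_not_eq2)
  moreover have "smooth_on UNIV (\<lambda>x::real. 1 + - 1 * x)"
    by (intro smooth_on_add smooth_on_mult smooth_on_const smooth_on_bounded_linear bounded_linear_ident
        open_UNIV)
  then have "smooth_on UNIV (\<lambda>x. exp_inverse 0 (1 + - 1 * x))"
    by (intro smooth_on_compose[OF _ _ _ smooth_on_exp_inverse]) simp_all
  ultimately show ?thesis
    unfolding smooth_step_def
    by (intro smooth_on_mult smooth_on_inverse smooth_on_add smooth_on_exp_inverse open_UNIV)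
qed

lemma smooth_cutoff_exists:
  fixes a :: "'e::real_inner"
  assumes "0 < r" "r < R"
  obtains \<psi> :: "'e \<Rightarrow> real"
  where "smooth_on UNIV \<psi>" "\<And>x. x \<in> cball a r \<Longrightarrow> \<psi> x = 1" "\<And>x. x \<notin> ball a R \<Longrightarrow> \<psi> x = 0"
proof
  define s where "s x = inverse (R\<^sup>2 - r\<^sup>2) * (R\<^sup>2 + - 1 * ((x + - a) \<bullet> (x + - a)))" for x
  have R: "R\<^sup>2 - r\<^sup>2 > 0" using assms by (simp add: power_strict_mono)
  have s: "s x = (R\<^sup>2 - (dist a x)\<^sup>2) / (R\<^sup>2 - r\<^sup>2)" for x
    by (simp add: s_def dist_norm norm_minus_commute[of a] power2_norm_eq_inner divide_inverse)
  have "Ck_on k UNIV s" for k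
    unfolding s_def
    by (intro Ck_on_mult Ck_on_inner Ck_on_add Ck_on_bounded_linear[OF _ bounded_linear_ident] Ck_on_const
        open_UNIV)
  then show "smooth_on UNIV (\<lambda>x. smooth_step (s x))"
    by (intro smooth_on_compose[OF _ _ _ smooth_on_smooth_step]) (auto simp: smooth_on_def)
  show "smooth_step (s x) = 1" if "x \<in> cball a r" for x
  proof (rule smooth_step_eq_1)
    have "(dist a x)\<^sup>2 \<le> r\<^sup>2" using that by (intro power_mono) auto
    with R show "s x \<ge> 1" by (simp add: s)
  qed
  show "smooth_step (s x) = 0" if "x \<notin> ball a R" for x
  proof (rule smooth_step_eq_0)
    have "R\<^sup>2 \<le> (dist a x)\<^sup>2" using that assms by (intro power_mono) auto
    with R show "s x \<le> 0" by (simp add: s divide_nonpos_pos)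
  qed
qed

subsection \<open>Hadamard's lemma\<close>

lemma has_derivative_parametric_integral:
  fixes f :: "'e::euclidean_space \<Rightarrow> 'd::euclidean_space \<Rightarrow> 'f::banach"
  assumes S: "open S" "convex S" "x \<in> S"
    and f: "\<And>x. x \<in> S \<Longrightarrow> continuous_on (cbox a b) (f x)"
    and deriv: "\<And>x t. x \<in> S \<Longrightarrow> t \<in> cbox a b \<Longrightarrow> ((\<lambda>x. f x t) has_derivative f' x t) (at x)"
    and f': "\<And>v. continuous_on (S \<times> cbox a b) (\<lambda>(x, t). f' x t v)"
  shows "((\<lambda>x. integral (cbox a b) (f x)) has_derivative (\<lambda>v. integral (cbox a b) (\<lambda>t. f' x t v))) (at x)"
proof -
  define D where "D x t = Blinfun (f' x t)" for x t
  have D_apply: "blinfun_apply (D x t) = f' x t" if "x \<in> S" "t \<in> cbox a b" for x t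
    using deriv[OF that] by (simp add: D_def bounded_linear_Blinfun_apply has_derivative_bounded_linear)
  have cont_D: "continuous_on (S \<times> cbox a b) (\<lambda>(x, t). D x t)"
  proof (rule continuous_on_blinfun_componentwise)
    show "continuous_on (S \<times> cbox a b) (\<lambda>z. blinfun_apply (case z of (x, t) \<Rightarrow> D x t) v)" for v
      by (rule continuous_on_eq[OF f'[of v]]) (auto simp: D_apply)
  qed
  have cont_Dx: "continuous_on (cbox a b) (D x)"
    by (rule continuous_on_compose2[OF cont_D, where f = "\<lambda>t. (x, t)", simplified])
      (use S(3) in \<open>auto intro!: continuous_intros\<close>)
  have "((\<lambda>x. integral (cbox a b) (f x)) has_derivative integral (cbox a b) (D x)) (at x within S)"
  proof (rule leibniz_rule[OF _ integrable_continuous[OF f] cont_D S(3,2)])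
    show "((\<lambda>x. f x t) has_derivative blinfun_apply (D x t)) (at x within S)"
      if "x \<in> S" "t \<in> cbox a b" for x t
      using deriv[OF that] by (simp add: D_apply[OF that] has_derivative_at_withinI)
  qed
  moreover have "blinfun_apply (integral (cbox a b) (D x)) = (\<lambda>v. integral (cbox a b) (\<lambda>t. f' x t v))"
    using S(3) by (auto simp: blinfun_apply_integral[OF integrable_continuous[OF cont_Dx]] D_apply
        intro!: ext integral_cong)
  ultimately show ?thesis using at_within_open[OF S(3,1)] by simp
qed

lemma convex_segment_mem:
  assumes "convex S" "a \<in> S" "x \<in> S" "t \<in> {0..1}"
  shows "a + t *\<^sub>R (x - a) \<in> S"
  using convexD_alt[OF assms(1-3), of t] assms(4) by (simp add: algebra_simps)

lemma continuous_on_segment: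
  fixes f :: "'e::real_normed_vector \<Rightarrow> 'f::topological_space"
  assumes "convex S" "a \<in> S" "continuous_on S f"
  shows "continuous_on (S \<times> {0..1}) (\<lambda>z. f (a + snd z *\<^sub>R (fst z - a)))"
proof (rule continuous_on_compose2[OF assms(3)])
  show "continuous_on (S \<times> {0..1}) (\<lambda>z. a + snd z *\<^sub>R (fst z - a))"
    by (intro continuous_intros)
  show "(\<lambda>z. a + snd z *\<^sub>R (fst z - a)) ` (S \<times> {0..1}) \<subseteq> S"
    using convex_segment_mem[OF assms(1,2)] by auto
qed

lemma continuous_on_along_segment:
  fixes f :: "'e::real_normed_vector \<Rightarrow> 'f::topological_space"
  assumes "convex S" "a \<in> S" "x \<in> S" "continuous_on S f"
  shows "continuous_on {0..1} (\<lambda>t. f (a + t *\<^sub>R (x - a)))"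
  by (rule continuous_on_compose2[OF assms(4)])
    (use convex_segment_mem[OF assms(1-3)] in \<open>auto intro!: continuous_intros\<close>)

lemma has_derivative_along_segment:
  assumes "(f has_derivative f') (at (a + t *\<^sub>R (x - a)))"
  shows "((\<lambda>x. f (a + t *\<^sub>R (x - a))) has_derivative (\<lambda>v. t *\<^sub>R f' v)) (at x)"
proof -
  have "((\<lambda>x. a + t *\<^sub>R (x - a)) has_derivative (\<lambda>v. t *\<^sub>R v)) (at x)"
    by (auto intro!: derivative_eq_intros)
  from has_derivative_compose[OF this assms] show ?thesis
    by (simp add: linear_scale[OF has_derivative_linear[OF assms]])
qed

text \<open>The weight \<open>t ^ n\<close> is there for the induction: each derivative produces another factor \<open>t\<close>.\<close>

lemma Ck_on_segment_integral:
  fixes f :: "'e::euclidean_space \<Rightarrow> 'f::banach"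
  assumes S: "open S" "convex S" "a \<in> S" and "Ck_on k S f"
  shows "Ck_on k S (\<lambda>x. integral {0..1} (\<lambda>t. t ^ n *\<^sub>R f (a + t *\<^sub>R (x - a))))"
  using assms(4)
proof (induction k arbitrary: f n)
  case 0
  then have "continuous_on (S \<times> {0..1}) (\<lambda>(x, t). t ^ n *\<^sub>R f (a + t *\<^sub>R (x - a)))"
    unfolding case_prod_unfold by (intro continuous_intros continuous_on_segment[OF S(2,3)]) simp
  then show ?case
    using integral_continuous_on_param[of S 0 1 "\<lambda>x t. t ^ n *\<^sub>R f (a + t *\<^sub>R (x - a))"] by simp
next
  case (Suc k)
  let ?f' = "\<lambda>x. frechet_derivative f (at x)"
  have f': "(f has_derivative ?f' x) (at x)" if "x \<in> S" for x
    by (rule Ck_on_Suc_has_derivative[OF Suc.prems that])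
  have Ck_f': "Ck_on k S (\<lambda>x. ?f' x v)" for v using Suc.prems by simp
  show ?case
  proof (rule Ck_on_SucI[OF S(1)], rule has_derivative_parametric_integral
      [OF S(1,2), where a = 0 and b = "1::real", unfolded box_real])
    fix x t assume x: "x \<in> S" and t: "t \<in> {0..1::real}"
    note has_derivative_along_segment[OF f'[OF convex_segment_mem[OF S(2,3) x t]]]
    from has_derivative_scaleR_right[OF this, of "t ^ n"]
    show "((\<lambda>x. t ^ n *\<^sub>R f (a + t *\<^sub>R (x - a))) has_derivative
        (\<lambda>v. t ^ Suc n *\<^sub>R ?f' (a + t *\<^sub>R (x - a)) v)) (at x)"
      by (simp add: mult.commute)
  next
    show "continuous_on {0..1} (\<lambda>t. t ^ n *\<^sub>R f (a + t *\<^sub>R (x - a)))" if "x \<in> S" for x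
      by (intro continuous_intros continuous_on_along_segment[OF S(2,3) that]
          Ck_on_imp_continuous_on[OF Suc.prems])
  next
    show "continuous_on (S \<times> {0..1}) (\<lambda>(x, t). t ^ Suc n *\<^sub>R ?f' (a + t *\<^sub>R (x - a)) v)" for v
      unfolding case_prod_unfold
      by (intro continuous_intros continuous_on_segment[OF S(2,3) Ck_on_imp_continuous_on[OF Ck_f']])
  qed (use Suc.IH[OF Ck_f'] in blast)+
qed

lemma diff_eq_integral_frechet_derivative:
  fixes f :: "'e::euclidean_space \<Rightarrow> 'f::banach"
  assumes "convex S" "a \<in> S" "x \<in> S" "smooth_on S f"
  shows "f x - f a = integral {0..1} (\<lambda>t. frechet_derivative f (at (a + t *\<^sub>R (x - a))) (x - a))"
proof -
  let ?f' = "\<lambda>t. frechet_derivative f (at (a + t *\<^sub>R (x - a)))"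
  have "((\<lambda>t. ?f' t (x - a)) has_integral f (a + 1 *\<^sub>R (x - a)) - f (a + 0 *\<^sub>R (x - a))) {0..1}"
  proof (rule fundamental_theorem_of_calculus)
    fix t :: real assume "t \<in> {0..1}"
    then have f': "(f has_derivative ?f' t) (at (a + t *\<^sub>R (x - a)))"
      by (intro smooth_on_has_derivative[OF assms(4)] convex_segment_mem assms(1-3))
    have "((\<lambda>t. a + t *\<^sub>R (x - a)) has_derivative (\<lambda>s. s *\<^sub>R (x - a))) (at t within {0..1})"
      by (auto intro!: derivative_eq_intros)
    from has_derivative_compose[OF this f']
    show "((\<lambda>t. f (a + t *\<^sub>R (x - a))) has_vector_derivative ?f' t (x - a)) (at t within {0..1})"
      by (simp add: has_vector_derivative_def linear_scale[OF has_derivative_linear[OF f']])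
  qed simp
  then show ?thesis by (simp add: integral_unique)
qed

lemma hadamard:
  fixes f :: "'e::euclidean_space \<Rightarrow> 'f::banach"
  assumes S: "open S" "convex S" "a \<in> S" and f: "smooth_on S f"
  obtains h where "\<And>b. smooth_on S (h b)" "\<And>b. h b a = frechet_derivative f (at a) b"
    "\<And>x. x \<in> S \<Longrightarrow> f x = f a + (\<Sum>b\<in>Basis. ((x - a) \<bullet> b) *\<^sub>R h b x)"
proof
  let ?f' = "\<lambda>x t. frechet_derivative f (at (a + t *\<^sub>R (x - a)))"
  define h where "h = (\<lambda>b x. integral {0..1} (\<lambda>t. ?f' x t b))"
  note smooth_f' = smooth_on_frechet_derivative[OF f]
  show "smooth_on S (h b)" for b
    unfolding smooth_on_def
  proof
    show "Ck_on k S (h b)" for k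
      using Ck_on_segment_integral[OF S, of k "\<lambda>y. frechet_derivative f (at y) b" 0] smooth_f'[of b]
      by (simp add: h_def smooth_on_def)
  qed
  show "h b a = frechet_derivative f (at a) b" for b
    by (simp add: h_def)
  show "f x = f a + (\<Sum>b\<in>Basis. ((x - a) \<bullet> b) *\<^sub>R h b x)" if x: "x \<in> S" for x
  proof -
    have integrable: "(\<lambda>t. ?f' x t b) integrable_on {0..1}" for b
      by (intro integrable_continuous_real
          continuous_on_along_segment[OF S(2,3) x smooth_on_imp_continuous_on[OF smooth_f']])
    have "f x - f a = integral {0..1} (\<lambda>t. ?f' x t (x - a))"
      by (rule diff_eq_integral_frechet_derivative[OF S(2,3) x f])
    also have "\<dots> = integral {0..1} (\<lambda>t. \<Sum>b\<in>Basis. ((x - a) \<bullet> b) *\<^sub>R ?f' x t b)"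
    proof (rule integral_cong)
      fix t :: real assume "t \<in> {0..1}"
      then have "linear (?f' x t)"
        by (intro has_derivative_linear[OF smooth_on_has_derivative[OF f]] convex_segment_mem[OF S(2,3) x])
      then show "?f' x t (x - a) = (\<Sum>b\<in>Basis. ((x - a) \<bullet> b) *\<^sub>R ?f' x t b)"
        by (rule linear_eq_sum_Basis)
    qed
    also have "\<dots> = (\<Sum>b\<in>Basis. ((x - a) \<bullet> b) *\<^sub>R h b x)"
      by (simp add: h_def integral_sum integrable_cmul integrable)
    finally show ?thesis by (simp add: algebra_simps)
  qed
qed

section \<open>Linear systems over a ring of functions\<close>

locale unital_subring =
  fixes S :: "'b::comm_ring_1 set"
  assumes one_closed: "1 \<in> S"
    and uminus_closed: "a \<in> S \<Longrightarrow> - a \<in> S"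
    and add_closed: "a \<in> S \<Longrightarrow> b \<in> S \<Longrightarrow> a + b \<in> S"
    and mult_closed: "a \<in> S \<Longrightarrow> b \<in> S \<Longrightarrow> a * b \<in> S"
begin

lemma zero_closed: "0 \<in> S"
  using add_closed[OF one_closed uminus_closed[OF one_closed]] by simp

lemma sum_closed: "(\<And>i. i \<in> I \<Longrightarrow> f i \<in> S) \<Longrightarrow> sum f I \<in> S"
  by (induction I rule: infinite_finite_induct) (auto intro: zero_closed add_closed)

lemma prod_closed: "(\<And>i. i \<in> I \<Longrightarrow> f i \<in> S) \<Longrightarrow> prod f I \<in> S"
  by (induction I rule: infinite_finite_induct) (auto intro: one_closed mult_closed)

lemma power_closed: "a \<in> S \<Longrightarrow> a ^ m \<in> S"
  by (induction m) (simp_all add: one_closed mult_closed)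

lemma det_closed:
  assumes B: "B \<in> carrier_mat n n" and entries: "\<And>i j. i < n \<Longrightarrow> j < n \<Longrightarrow> B $$ (i, j) \<in> S"
  shows "det B \<in> S"
proof -
  have "signof p \<in> S" for p :: "nat \<Rightarrow> nat"
    by (simp add: sign_def one_closed uminus_closed)
  then show ?thesis
    unfolding det_def'[OF B]
    by (intro sum_closed mult_closed prod_closed entries) (auto dest: permutes_in_image)
qed

lemma adj_mat_closed:
  assumes B: "B \<in> carrier_mat n n" and entries: "\<And>i j. i < n \<Longrightarrow> j < n \<Longrightarrow> B $$ (i, j) \<in> S"
    and ij: "i < n" "j < n"
  shows "adj_mat B $$ (i, j) \<in> S"
proof -
  have "det (mat_delete B j i) \<in> S"
  proof (rule det_closed[OF mat_delete_carrier[OF B]])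
    show "mat_delete B j i $$ (k, l) \<in> S" if "k < n - 1" "l < n - 1" for k l
      using that B by (auto simp: mat_delete_def intro!: entries)
  qed
  then show ?thesis
    using B ij by (simp add: adj_mat_def cofactor_def mult_closed power_closed uminus_closed one_closed)
qed

end

lemma mult_adj_mat_vec:
  fixes B :: "'b::comm_ring_1 mat"
  assumes B: "B \<in> carrier_mat n n" and w: "w \<in> carrier_vec n"
  shows "B *\<^sub>v (adj_mat B *\<^sub>v w) = det B \<cdot>\<^sub>v w"
proof -
  have "B *\<^sub>v (adj_mat B *\<^sub>v w) = (B * adj_mat B) *\<^sub>v w"
    by (rule assoc_mult_mat_vec[OF B adj_mat(1)[OF B] w, symmetric])
  also have "\<dots> = det B \<cdot>\<^sub>v (1\<^sub>m n *\<^sub>v w)"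
    unfolding adj_mat(2)[OF B] by (rule eq_vecI) (use w in auto)
  finally show ?thesis using w by simp
qed

lemma mat_mult_vec_index:
  "i < n \<Longrightarrow> (mat n n (\<lambda>(i, j). G i j) *\<^sub>v vec n v) $ i = (\<Sum>j<n. G i j * v j)"
  by (auto simp: scalar_prod_def lessThan_atLeast0 intro!: sum.cong)

lemma det_nonzero_if_injective:
  fixes G :: "nat \<Rightarrow> nat \<Rightarrow> 'b::field"
  assumes "\<And>v j. (\<And>i. i < n \<Longrightarrow> (\<Sum>k<n. G i k * v k) = 0) \<Longrightarrow> j < n \<Longrightarrow> v j = 0"
  shows "det (mat n n (\<lambda>(i, j). G i j)) \<noteq> 0"
proof
  let ?B = "mat n n (\<lambda>(i, j). G i j)"
  assume "det ?B = 0"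
  then obtain v where v: "v \<in> carrier_vec n" "v \<noteq> 0\<^sub>v n" "?B *\<^sub>v v = 0\<^sub>v n"
    using det_0_iff_vec_prod_zero_field[of ?B n] by auto
  have "v = vec n (($) v)" using v(1) by auto
  then have "(\<Sum>k<n. G i k * v $ k) = 0" if "i < n" for i
    using mat_mult_vec_index[OF that, of G "($) v"] v(3) that by simp
  then have "v $ j = 0" if "j < n" for j using assms[of "($) v"] that by blast
  then have "v = 0\<^sub>v n" using v(1) by (intro eq_vecI) auto
  with v(2) show False ..
qed

lemma linear_system_solvable_at_lessThan:
  fixes G :: "nat \<Rightarrow> nat \<Rightarrow> 'a \<Rightarrow> 'b::field"
  assumes S: "unital_subring S"
    and G: "\<And>i j. i < n \<Longrightarrow> j < n \<Longrightarrow> G i j \<in> S" and w: "\<And>i. i < n \<Longrightarrow> w i \<in> S"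
    and inj: "\<And>v j. (\<And>i. i < n \<Longrightarrow> (\<Sum>k<n. G i k p * v k) = 0) \<Longrightarrow> j < n \<Longrightarrow> v j = 0"
  obtains d a where "d \<in> S" "d p \<noteq> 0" "\<And>j. j < n \<Longrightarrow> a j \<in> S"
    "\<And>i. i < n \<Longrightarrow> (\<Sum>j<n. G i j * a j) = d * w i"
proof
  interpret unital_subring S by (rule S)
  define B where "B = mat n n (\<lambda>(i, j). G i j)"
  define a where "a j = (adj_mat B *\<^sub>v vec n w) $ j" for j
  have B: "B \<in> carrier_mat n n" by (simp add: B_def)
  have entries: "B $$ (i, j) \<in> S" if "i < n" "j < n" for i j
    using G that by (simp add: B_def)
  show "det B \<in> S" by (rule det_closed[OF B entries])
  interpret eval: comm_ring_hom "\<lambda>f :: 'a \<Rightarrow> 'b. f p"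
    by unfold_locales auto
  have "det B p = det (mat n n (\<lambda>(i, j). G i j p))"
    unfolding B_def eval.hom_det[symmetric] by (rule arg_cong[where f = det]) auto
  also have "\<dots> \<noteq> 0"
    by (rule det_nonzero_if_injective) (blast intro: inj)
  finally show "det B p \<noteq> 0" .
  have "a j = (\<Sum>k<n. adj_mat B $$ (j, k) * w k)" if "j < n" for j
    using that B adj_mat(1)[OF B] by (auto simp: a_def scalar_prod_def lessThan_atLeast0 intro!: sum.cong)
  then show "a j \<in> S" if "j < n" for j
    using that by (auto intro!: sum_closed mult_closed adj_mat_closed[OF B entries] w)
  have adj_w: "vec n a = adj_mat B *\<^sub>v vec n w"
    using adj_mat(1)[OF B] by (intro eq_vecI) (auto simp: a_def)
  show "(\<Sum>j<n. G i j * a j) = det B * w i" if "i < n" for i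
    using mat_mult_vec_index[OF that, of G a] mult_adj_mat_vec[OF B, of "vec n w"] that
    by (simp add: adj_w B_def[symmetric])
qed

lemma linear_system_solvable_at:
  fixes G :: "'i \<Rightarrow> 'i \<Rightarrow> 'a \<Rightarrow> 'b::field"
  assumes S: "unital_subring S" and I: "finite I"
    and G: "\<And>i j. i \<in> I \<Longrightarrow> j \<in> I \<Longrightarrow> G i j \<in> S" and w: "\<And>i. i \<in> I \<Longrightarrow> w i \<in> S"
    and inj: "\<And>v j. (\<And>i. i \<in> I \<Longrightarrow> (\<Sum>k\<in>I. G i k p * v k) = 0) \<Longrightarrow> j \<in> I \<Longrightarrow> v j = 0"
  obtains d a where "d \<in> S" "d p \<noteq> 0" "\<And>j. j \<in> I \<Longrightarrow> a j \<in> S"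
    "\<And>i. i \<in> I \<Longrightarrow> (\<Sum>j\<in>I. G i j * a j) = d * w i"
proof -
  define n where "n = card I"
  obtain e where e: "bij_betw e {..<n} I"
    using ex_bij_betw_nat_finite[OF I] by (auto simp: n_def lessThan_atLeast0)
  define e' where "e' = inv_into {..<n} e"
  have e_mem: "e i \<in> I" and e'_e: "e' (e i) = i" if "i < n" for i
    using e that by (auto simp: e'_def bij_betw_def)
  have e'_mem: "e' j < n" and e_e': "e (e' j) = j" if "j \<in> I" for j
    using that bij_betwE[OF bij_betw_inv_into[OF e]] bij_betw_inv_into_right[OF e] by (auto simp: e'_def)
  have reindex: "(\<Sum>j\<in>I. f j) = (\<Sum>j<n. f (e j))" for f :: "'i \<Rightarrow> 'c::comm_monoid_add"
    by (rule sum.reindex_bij_betw[OF e, symmetric])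
  obtain d a where d: "d \<in> S" "d p \<noteq> 0" and a: "\<And>j. j < n \<Longrightarrow> a j \<in> S"
    and solves: "\<And>i. i < n \<Longrightarrow> (\<Sum>j<n. G (e i) (e j) * a j) = d * w (e i)"
  proof (rule linear_system_solvable_at_lessThan[OF S, of n "\<lambda>i j. G (e i) (e j)" "\<lambda>i. w (e i)" p])
    fix v j assume v: "\<And>i. i < n \<Longrightarrow> (\<Sum>k<n. G (e i) (e k) p * v k) = 0" and j: "j < n"
    have "v (e' (e j)) = 0"
    proof (rule inj[OF _ e_mem[OF j]])
      show "(\<Sum>k\<in>I. G i k p * v (e' k)) = 0" if "i \<in> I" for i
        using v[OF e'_mem[OF that]] by (simp add: reindex e'_e e_e'[OF that])
    qed
    then show "v j = 0" by (simp add: e'_e[OF j])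
  qed (blast intro: G w e_mem)+
  show ?thesis
  proof
    show "a (e' j) \<in> S" if "j \<in> I" for j by (rule a[OF e'_mem[OF that]])
    show "(\<Sum>j\<in>I. G i j * a (e' j)) = d * w i" if "i \<in> I" for i
      using solves[OF e'_mem[OF that]] by (simp add: reindex e'_e e_e'[OF that])
  qed (use d in auto)
qed

section \<open>Smooth functions on a manifold\<close>

locale manifold =
  fixes M :: "'a topology" and A :: "('a, 'e::euclidean_space) chart set"
  assumes manifold: "smooth_manifold M A"
begin

abbreviation "C \<equiv> smooth_functions M A"

lemma chart:
  assumes "(U, c) \<in> A"
  shows chart_openin: "openin M U" and chart_open_image: "open (c ` U)"
    and chart_homeomorphic: "homeomorphic_map (subtopology M U) (top_of_set (c ` U)) c"
    and chart_subset: "U \<subseteq> topspace M" and chart_inj: "inj_on c U"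
proof -
  have "chart_on M (U, c)" using manifold assms by (auto simp: smooth_manifold_def)
  then show U: "openin M U" and "open (c ` U)"
    and homeomorphic: "homeomorphic_map (subtopology M U) (top_of_set (c ` U)) c"
    by (auto simp: chart_on_def)
  show "U \<subseteq> topspace M" by (rule openin_subset[OF U])
  then show "inj_on c U"
    using homeomorphic_imp_injective_map[OF homeomorphic] by (simp add: Int_absorb1)
qed

lemma chart_ex:
  assumes "p \<in> topspace M"
  obtains U c where "(U, c) \<in> A" "p \<in> U"
proof -
  have "p \<in> (\<Union>(U, c)\<in>A. U)" using manifold assms by (simp add: smooth_manifold_def)
  then show ?thesis using that by auto
qed

lemma chart_image_open:
  assumes "(U, c) \<in> A" "openin M W" "W \<subseteq> U"
  shows "open (c ` W)"
proof -
  have "openin (subtopology M U) W"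
    using assms(2,3) by (metis openin_subtopology_Int2 inf.absorb_iff2)
  then have "openin (top_of_set (c ` U)) (c ` W)"
    using homeomorphic_imp_open_map[OF chart_homeomorphic[OF assms(1)]] by (simp add: open_map_def)
  then show ?thesis
    using openin_open_trans chart_open_image[OF assms(1)] by blast
qed

lemma chart_vimage_openin:
  assumes "(U, c) \<in> A" "open T"
  shows "openin M {q \<in> U. c q \<in> T}"
proof -
  have "openin (top_of_set (c ` U)) (c ` U \<inter> T)" using assms(2) by auto
  then have "openin (subtopology M U) {q \<in> topspace (subtopology M U). c q \<in> c ` U \<inter> T}"
    using homeomorphic_imp_continuous_map[OF chart_homeomorphic[OF assms(1)]]
    by (rule openin_continuous_map_preimage[rotated])
  moreover have "{q \<in> topspace (subtopology M U). c q \<in> c ` U \<inter> T} = {q \<in> U. c q \<in> T}"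
    using chart_subset[OF assms(1)] by auto
  ultimately show ?thesis
    using openin_trans_full chart_openin[OF assms(1)] by metis
qed

lemma chart_vimage_closedin:
  assumes "(U, c) \<in> A" "compact T" "T \<subseteq> c ` U"
  shows "closedin M {q \<in> U. c q \<in> T}"
proof -
  obtain d where d: "homeomorphic_maps (subtopology M U) (top_of_set (c ` U)) c d"
    using chart_homeomorphic[OF assms(1)] homeomorphic_map_maps by blast
  have "d (c q) = q" if "q \<in> U" for q
    using d that chart_subset[OF assms(1)] by (auto simp: homeomorphic_maps_def)
  then have "d ` T = {q \<in> U. c q \<in> T}" using assms(3) by force
  moreover have "compactin (top_of_set (c ` U)) T"
    using assms(2,3) by (simp add: compactin_subtopology)
  then have "compactin (subtopology M U) (d ` T)"
    using d image_compactin by (metis homeomorphic_maps_def)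
  then have "compactin M (d ` T)" by (simp add: compactin_subtopology)
  ultimately show ?thesis
    using manifold compactin_imp_closedin by (metis smooth_manifold_def)
qed

lemma chart_inv:
  assumes "(U, c) \<in> A" "q \<in> U"
  shows "inv_into U c (c q) = q"
  using chart_inj[OF assms(1)] assms(2) by simp

subsection \<open>Smoothness at a point\<close>

definition smooth_at :: "'a sfun \<Rightarrow> 'a \<Rightarrow> bool" where
  "smooth_at f p \<longleftrightarrow> (\<exists>(U, c)\<in>A. \<exists>W. openin M W \<and> p \<in> W \<and> W \<subseteq> U \<and> smooth_on (c ` W) (f \<circ> inv_into U c))"

lemma smooth_atI:
  assumes U: "(U, c) \<in> A" and W: "openin M W" "p \<in> W" "W \<subseteq> U"
    and F: "smooth_on (c ` W) F" "\<And>q. q \<in> W \<Longrightarrow> f q = F (c q)"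
  shows "smooth_at f p"
proof -
  have "smooth_on (c ` W) (f \<circ> inv_into U c)"
    by (rule smooth_on_cong[OF chart_image_open[OF U W(1,3)] _ F(1)])
      (use W(3) F(2) chart_inv[OF U] in auto)
  then show ?thesis using U W unfolding smooth_at_def by blast
qed

lemma smooth_at_obtain_chart:
  assumes "smooth_at f p"
  obtains U c W where "(U, c) \<in> A" "openin M W" "p \<in> W" "W \<subseteq> U" "smooth_on (c ` W) (f \<circ> inv_into U c)"
  using assms unfolding smooth_at_def by blast

lemma smooth_at_in_chart:
  assumes f: "smooth_at f p" and V: "(V, d) \<in> A" "p \<in> V"
  obtains W where "openin M W" "p \<in> W" "W \<subseteq> V" "smooth_on (d ` W) (f \<circ> inv_into V d)"
proof -
  obtain U c W' where U: "(U, c) \<in> A" and W': "openin M W'" "p \<in> W'" "W' \<subseteq> U"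
    and f_c: "smooth_on (c ` W') (f \<circ> inv_into U c)"
    by (rule smooth_at_obtain_chart[OF f])
  define W where "W = V \<inter> W'"
  have W: "openin M W" "p \<in> W" "W \<subseteq> V" "W \<subseteq> U"
    using W' V(2) chart_openin[OF V(1)] by (auto simp: W_def)
  have dW: "open (d ` W)" by (rule chart_image_open[OF V(1) W(1,3)])
  have "\<forall>(V, d)\<in>A. \<forall>(U, c)\<in>A. smooth_on (d ` (V \<inter> U)) (c \<circ> inv_into V d)"
    using manifold by (simp add: smooth_manifold_def)
  then have "smooth_on (d ` (V \<inter> U)) (c \<circ> inv_into V d)"
    using U V(1) by fast
  then have transition: "smooth_on (d ` W) (c \<circ> inv_into V d)"
    by (rule smooth_on_subset) (use W in blast)
  have "smooth_on (d ` W) (\<lambda>x. (f \<circ> inv_into U c) ((c \<circ> inv_into V d) x))"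
    by (rule smooth_on_compose[OF dW chart_image_open[OF U W'(1,3)] _ f_c transition])
      (auto simp: W_def chart_inv[OF V(1)])
  then have "smooth_on (d ` W) (f \<circ> inv_into V d)"
    by (rule smooth_on_cong[OF dW, rotated])
      (auto simp: chart_inv[OF V(1) subsetD[OF W(3)]] chart_inv[OF U subsetD[OF W(4)]])
  with W show ?thesis by (intro that)
qed

lemma smooth_at_common_chart:
  assumes f: "smooth_at f p" and h: "smooth_at h p"
  obtains U c W where "(U, c) \<in> A" "openin M W" "p \<in> W" "W \<subseteq> U"
    "smooth_on (c ` W) (f \<circ> inv_into U c)" "smooth_on (c ` W) (h \<circ> inv_into U c)"
proof -
  obtain U c W where U: "(U, c) \<in> A" and W: "openin M W" "p \<in> W" "W \<subseteq> U"
    and f_c: "smooth_on (c ` W) (f \<circ> inv_into U c)"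
    by (rule smooth_at_obtain_chart[OF f])
  obtain W' where W': "openin M W'" "p \<in> W'" and h_c: "smooth_on (c ` W') (h \<circ> inv_into U c)"
    by (rule smooth_at_in_chart[OF h U subsetD[OF W(3,2)]])
  show ?thesis
  proof (rule that[OF U, of "W \<inter> W'"])
    show "smooth_on (c ` (W \<inter> W')) (f \<circ> inv_into U c)" "smooth_on (c ` (W \<inter> W')) (h \<circ> inv_into U c)"
      using smooth_on_subset[OF f_c] smooth_on_subset[OF h_c] by (simp_all add: image_mono)
  qed (use W W' in auto)
qed

lemma smooth_at_imp_openin:
  assumes "smooth_at f p"
  obtains W where "openin M W" "p \<in> W" "\<And>q. q \<in> W \<Longrightarrow> smooth_at f q"
proof -
  obtain U c W where "(U, c) \<in> A" "openin M W" "p \<in> W" "W \<subseteq> U" "smooth_on (c ` W) (f \<circ> inv_into U c)"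
    by (rule smooth_at_obtain_chart[OF assms])
  then show ?thesis by (intro that[of W]) (auto simp: smooth_at_def)
qed

lemma smooth_at_imp_in_topspace: "smooth_at f p \<Longrightarrow> p \<in> topspace M"
  unfolding smooth_at_def using openin_subset by blast

lemma smooth_at_cong:
  assumes "openin M W" "p \<in> W" "\<And>q. q \<in> W \<Longrightarrow> f q = h q" "smooth_at h p"
  shows "smooth_at f p"
proof -
  obtain U c W' where U: "(U, c) \<in> A" and W': "openin M W'" "p \<in> W'" "W' \<subseteq> U"
    and h: "smooth_on (c ` W') (h \<circ> inv_into U c)"
    by (rule smooth_at_obtain_chart[OF assms(4)])
  show ?thesis
  proof (rule smooth_atI[OF U, of "W \<inter> W'"])
    show "smooth_on (c ` (W \<inter> W')) (h \<circ> inv_into U c)"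
      by (rule smooth_on_subset[OF h]) auto
  qed (use assms(1-3) W' chart_inv[OF U] in auto)
qed

lemma smooth_at_const:
  assumes "p \<in> topspace M"
  shows "smooth_at (\<lambda>_. a) p"
proof -
  obtain U c where U: "(U, c) \<in> A" "p \<in> U" using assms by (rule chart_ex)
  show ?thesis
    by (rule smooth_atI[OF U(1) chart_openin[OF U(1)] U(2) order_refl
          smooth_on_const[OF chart_open_image[OF U(1)]]]) simp
qed

lemma smooth_at_add:
  assumes "smooth_at f p" "smooth_at h p"
  shows "smooth_at (f + h) p"
proof -
  obtain U c W where U: "(U, c) \<in> A" and W: "openin M W" "p \<in> W" "W \<subseteq> U"
    and smooth: "smooth_on (c ` W) (f \<circ> inv_into U c)" "smooth_on (c ` W) (h \<circ> inv_into U c)"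
    by (rule smooth_at_common_chart[OF assms])
  show ?thesis
    by (rule smooth_atI[OF U W smooth_on_add[OF chart_image_open[OF U W(1,3)] smooth]])
      (use W(3) chart_inv[OF U] in auto)
qed

lemma smooth_at_mult:
  assumes "smooth_at f p" "smooth_at h p"
  shows "smooth_at (f * h) p"
proof -
  obtain U c W where U: "(U, c) \<in> A" and W: "openin M W" "p \<in> W" "W \<subseteq> U"
    and smooth: "smooth_on (c ` W) (f \<circ> inv_into U c)" "smooth_on (c ` W) (h \<circ> inv_into U c)"
    by (rule smooth_at_common_chart[OF assms])
  show ?thesis
    by (rule smooth_atI[OF U W smooth_on_mult[OF chart_image_open[OF U W(1,3)] smooth]])
      (use W(3) chart_inv[OF U] in auto)
qed

lemma smooth_at_nonzero_nearby:
  assumes f: "smooth_at f p" and "f p \<noteq> 0"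
  obtains W where "openin M W" "p \<in> W" "\<And>q. q \<in> W \<Longrightarrow> f q \<noteq> 0"
proof -
  obtain U c W where U: "(U, c) \<in> A" and W: "openin M W" "p \<in> W" "W \<subseteq> U"
    and f_c: "smooth_on (c ` W) (f \<circ> inv_into U c)"
    by (rule smooth_at_obtain_chart[OF f])
  define T where "T = c ` W \<inter> (f \<circ> inv_into U c) -` (- {0})"
  have T: "open T"
    unfolding T_def using chart_image_open[OF U W(1,3)]
    by (rule continuous_open_preimage[OF smooth_on_imp_continuous_on[OF f_c]]) (simp add: open_Compl)
  have "p \<in> {q \<in> U. c q \<in> T}"
    using W assms(2) chart_inv[OF U, of p] by (auto simp: T_def)
  moreover have "f q \<noteq> 0" if "q \<in> {q \<in> U. c q \<in> T}" for q
    using that chart_inv[OF U, of q] by (simp add: T_def)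
  ultimately show ?thesis by (rule that[OF chart_vimage_openin[OF U T]])
qed

lemma smooth_at_inverse:
  assumes "smooth_at f p" "f p \<noteq> 0"
  shows "smooth_at (\<lambda>q. inverse (f q)) p"
proof -
  obtain U c W where U: "(U, c) \<in> A" and W: "openin M W" "p \<in> W" "W \<subseteq> U"
    and f: "smooth_on (c ` W) (f \<circ> inv_into U c)"
    by (rule smooth_at_obtain_chart[OF assms(1)])
  obtain W' where W': "openin M W'" "p \<in> W'" and nonzero: "\<And>q. q \<in> W' \<Longrightarrow> f q \<noteq> 0"
    by (rule smooth_at_nonzero_nearby[OF assms]) blast
  show ?thesis
  proof (rule smooth_atI[OF U openin_Int[OF W(1) W'(1)]])
    show "smooth_on (c ` (W \<inter> W')) (\<lambda>x. inverse ((f \<circ> inv_into U c) x))"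
    proof (rule smooth_on_inverse[OF chart_image_open[OF U openin_Int[OF W(1) W'(1)]] _ smooth_on_subset[OF f]])
      show "(f \<circ> inv_into U c) x \<noteq> 0" if "x \<in> c ` (W \<inter> W')" for x
        using that nonzero W(3) chart_inv[OF U] by auto
    qed (use W(3) in auto)
  qed (use W W' chart_inv[OF U] in auto)
qed

lemma smooth_at_chart_coordinate:
  assumes U: "(U, c) \<in> A" "p \<in> U"
  shows "smooth_at (\<lambda>q. c q \<bullet> b) p"
  by (rule smooth_atI[OF U(1) chart_openin[OF U(1)] U(2) order_refl
        smooth_on_bounded_linear[OF chart_open_image[OF U(1)] bounded_linear_inner_left]]) simp

lemma unital_subring_smooth_at:
  assumes "p \<in> topspace M"
  shows "unital_subring {f. smooth_at f p}"
proof
  show "1 \<in> {f. smooth_at f p}"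
    using smooth_at_const[OF assms, of 1] by (simp add: one_fun_def)
  show "- f \<in> {f. smooth_at f p}" if "f \<in> {f. smooth_at f p}" for f
    using smooth_at_mult[OF smooth_at_const[OF assms, of "- 1"], of f] that
    by (simp add: times_fun_def fun_Compl_def)
qed (simp_all add: smooth_at_add smooth_at_mult)

subsection \<open>The ring of smooth functions\<close>

lemma smooth_functions_iff:
  "f \<in> C \<longleftrightarrow> (\<forall>p\<in>topspace M. smooth_at f p) \<and> (\<forall>p. p \<notin> topspace M \<longrightarrow> f p = 0)"
proof -
  have "smooth_on (c ` U) (f \<circ> inv_into U c)"
    if f: "\<forall>p\<in>topspace M. smooth_at f p" and U: "(U, c) \<in> A" for U c
  proof (rule smooth_on_locally)
    fix x assume "x \<in> c ` U"
    then obtain p where p: "p \<in> U" "x = c p" by blast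
    then obtain W where "openin M W" "p \<in> W" "W \<subseteq> U" "smooth_on (c ` W) (f \<circ> inv_into U c)"
      using smooth_at_in_chart[OF _ U, of f p] f chart_subset[OF U] by blast
    then show "\<exists>T. open T \<and> x \<in> T \<and> smooth_on T (f \<circ> inv_into U c)"
      using chart_image_open[OF U] p(2) by blast
  qed
  moreover have "smooth_at f p" if "\<forall>(U, c)\<in>A. smooth_on (c ` U) (f \<circ> inv_into U c)" "p \<in> topspace M" for p
  proof -
    obtain U c where "(U, c) \<in> A" "p \<in> U" using \<open>p \<in> topspace M\<close> by (rule chart_ex)
    then show ?thesis
      using that(1) chart_openin[of U c] unfolding smooth_at_def by blast
  qed
  ultimately show ?thesis unfolding smooth_functions_def by blast
qed

lemma smooth_function_smooth_at: "f \<in> C \<Longrightarrow> p \<in> topspace M \<Longrightarrow> smooth_at f p"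
  by (simp add: smooth_functions_iff)

lemma smooth_function_outside: "f \<in> C \<Longrightarrow> p \<notin> topspace M \<Longrightarrow> f p = 0"
  by (simp add: smooth_functions_iff)

lemma smooth_function_in_chart:
  "f \<in> C \<Longrightarrow> (U, c) \<in> A \<Longrightarrow> smooth_on (c ` U) (f \<circ> inv_into U c)"
  by (auto simp: smooth_functions_def)

definition const_fun :: "real \<Rightarrow> 'a sfun" where
  "const_fun a = (\<lambda>p. if p \<in> topspace M then a else 0)"

lemma const_fun_apply: "p \<in> topspace M \<Longrightarrow> const_fun a p = a"
  by (simp add: const_fun_def)

lemma const_fun_smooth: "const_fun a \<in> C"
proof -
  have "smooth_at (const_fun a) p" if "p \<in> topspace M" for p
    by (rule smooth_at_cong[OF openin_topspace that const_fun_apply smooth_at_const[OF that]])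
  then show ?thesis by (simp add: smooth_functions_iff const_fun_def)
qed

lemma const_mult_eq_const_fun_mult: "f \<in> C \<Longrightarrow> (\<lambda>_. a) * f = const_fun a * f"
  by (auto simp: const_fun_def smooth_function_outside)

lemma C_zero: "0 \<in> C"
  using const_fun_smooth[of 0] by (simp add: const_fun_def zero_fun_def)

lemma C_add: "f \<in> C \<Longrightarrow> h \<in> C \<Longrightarrow> f + h \<in> C"
  by (simp add: smooth_functions_iff smooth_at_add)

lemma C_mult: "f \<in> C \<Longrightarrow> h \<in> C \<Longrightarrow> f * h \<in> C"
  by (simp add: smooth_functions_iff smooth_at_mult)

lemma C_scale: "f \<in> C \<Longrightarrow> (\<lambda>_. a) * f \<in> C"
  by (simp add: const_mult_eq_const_fun_mult C_mult const_fun_smooth)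

lemma C_sum: "(\<And>i. i \<in> I \<Longrightarrow> f i \<in> C) \<Longrightarrow> sum f I \<in> C"
  by (induction I rule: infinite_finite_induct) (auto intro: C_add C_zero)

subsection \<open>Localisation by bump functions\<close>

lemma extension_by_zero:
  assumes W: "openin M W" and K: "closedin M K" "K \<subseteq> W"
    and f: "\<And>q. q \<in> W \<Longrightarrow> smooth_at f q" "\<And>q. q \<notin> K \<Longrightarrow> f q = 0"
  shows "f \<in> C"
proof -
  have "smooth_at f p" if "p \<in> topspace M" for p
  proof (cases "p \<in> W")
    case False
    then show ?thesis
      using that K f(2) by (intro smooth_at_cong[OF _ _ _ smooth_at_const[of _ 0], of "topspace M - K"]) auto
  qed (rule f(1))
  then show ?thesis using f(2) closedin_subset[OF K(1)] by (auto simp: smooth_functions_iff)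
qed

lemma cutoff_mult_smooth:
  assumes "openin M W" "closedin M K" "K \<subseteq> W" "\<beta> \<in> C" "\<And>q. q \<notin> K \<Longrightarrow> \<beta> q = 0"
    and "\<And>q. q \<in> W \<Longrightarrow> smooth_at f q"
  shows "\<beta> * f \<in> C"
proof (rule extension_by_zero[OF assms(1-3)])
  show "smooth_at (\<beta> * f) q" if "q \<in> W" for q
    using smooth_at_imp_in_topspace[OF assms(6)[OF that]]
    by (intro smooth_at_mult assms(6)[OF that] smooth_function_smooth_at[OF assms(4)])
qed (simp add: assms(5))

lemma bump_exists:
  assumes W: "openin M W" "p \<in> W"
  obtains \<beta> N K where "\<beta> \<in> C" "openin M N" "p \<in> N" "closedin M K" "K \<subseteq> W" "N \<subseteq> W"
    "\<And>q. q \<in> N \<Longrightarrow> \<beta> q = 1" "\<And>q. q \<notin> K \<Longrightarrow> \<beta> q = 0"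
proof -
  have "p \<in> topspace M" using W openin_subset by blast
  then obtain U c where U: "(U, c) \<in> A" "p \<in> U" by (rule chart_ex)
  have "open (c ` (U \<inter> W))" "c p \<in> c ` (U \<inter> W)"
    using chart_image_open[OF U(1) openin_Int[OF chart_openin[OF U(1)] W(1)]] U(2) W(2) by auto
  then obtain R where R: "R > 0" "cball (c p) R \<subseteq> c ` (U \<inter> W)"
    by (meson open_contains_cball)
  obtain \<psi> :: "'e \<Rightarrow> real" where \<psi>: "smooth_on UNIV \<psi>"
    "\<And>x. x \<in> cball (c p) (R / 2) \<Longrightarrow> \<psi> x = 1" "\<And>x. x \<notin> ball (c p) R \<Longrightarrow> \<psi> x = 0"
    using R(1) by (elim smooth_cutoff_exists[of "R / 2" R "c p", rotated 2]) simp_all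
  define \<beta> where "\<beta> q = (if q \<in> U then \<psi> (c q) else 0)" for q
  define K where "K = {q \<in> U. c q \<in> cball (c p) R}"
  define N where "N = {q \<in> U. c q \<in> ball (c p) (R / 2)}"
  have K: "closedin M K"
    unfolding K_def by (rule chart_vimage_closedin[OF U(1)]) (use R(2) in auto)
  have "openin M N"
    unfolding N_def by (rule chart_vimage_openin[OF U(1) open_ball])
  moreover have "N \<subseteq> K"
    using R(1) by (auto simp: N_def K_def)
  ultimately have N: "openin M N" "N \<subseteq> K" .
  have "K \<subseteq> W"
    using R(2) inj_onD[OF chart_inj[OF U(1)]] by (force simp: K_def)
  have \<beta>_0: "\<beta> q = 0" if "q \<notin> K" for q
    using that \<psi>(3) by (auto simp: \<beta>_def K_def)
  have "\<beta> \<in> C"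
  proof (rule extension_by_zero[OF chart_openin[OF U(1)] K])
    show "smooth_at \<beta> q" if "q \<in> U" for q
      by (rule smooth_atI[OF U(1) chart_openin[OF U(1)] that order_refl smooth_on_subset[OF \<psi>(1)]])
        (simp_all add: \<beta>_def)
  qed (auto simp: K_def \<beta>_0)
  moreover have "p \<in> N" using U(2) R(1) by (simp add: N_def)
  moreover have "\<beta> q = 1" if "q \<in> N" for q using that \<psi>(2) by (simp add: N_def \<beta>_def)
  moreover have "N \<subseteq> W" using N(2) \<open>K \<subseteq> W\<close> by blast
  ultimately show ?thesis using that[of \<beta> N K] N(1) K \<open>K \<subseteq> W\<close> \<beta>_0 by simp
qed

lemma bump_at_point:
  assumes W: "openin M W" "p \<in> W"
  obtains \<beta> where "\<beta> \<in> C" "\<beta> p = 1" "\<And>q. q \<notin> W \<Longrightarrow> \<beta> q = 0"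
proof -
  obtain \<beta> N K where \<beta>: "\<beta> \<in> C" and N: "p \<in> N" and K: "K \<subseteq> W"
    and \<beta>_1: "\<And>q. q \<in> N \<Longrightarrow> \<beta> q = 1" and \<beta>_0: "\<And>q. q \<notin> K \<Longrightarrow> \<beta> q = 0"
    by (rule bump_exists[OF W]) blast
  show ?thesis
    by (rule that[OF \<beta> \<beta>_1[OF N] \<beta>_0]) (use K in blast)
qed

lemma smooth_at_extends:
  assumes "smooth_at f p"
  obtains h N where "h \<in> C" "openin M N" "p \<in> N" "\<And>q. q \<in> N \<Longrightarrow> h q = f q"
proof -
  obtain W where W: "openin M W" "p \<in> W" and f: "\<And>q. q \<in> W \<Longrightarrow> smooth_at f q"
    by (rule smooth_at_imp_openin[OF assms]) blast
  obtain \<beta> N K where \<beta>: "\<beta> \<in> C" and N: "openin M N" "p \<in> N" and K: "closedin M K" "K \<subseteq> W"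
    and \<beta>_1: "\<And>q. q \<in> N \<Longrightarrow> \<beta> q = 1" and \<beta>_0: "\<And>q. q \<notin> K \<Longrightarrow> \<beta> q = 0"
    by (rule bump_exists[OF W]) blast
  have "\<beta> * f \<in> C" by (rule cutoff_mult_smooth[OF W(1) K \<beta> \<beta>_0 f])
  then show ?thesis by (rule that[OF _ N]) (simp add: \<beta>_1)
qed

lemma smooth_at_extends_finite:
  assumes I: "finite I" and p: "p \<in> topspace M" and f: "\<And>i. i \<in> I \<Longrightarrow> smooth_at (f i) p"
  obtains h N where "\<And>i. i \<in> I \<Longrightarrow> h i \<in> C" "openin M N" "p \<in> N"
    "\<And>i q. i \<in> I \<Longrightarrow> q \<in> N \<Longrightarrow> h i q = f i q"
proof -
  have "\<exists>h N. h \<in> C \<and> openin M N \<and> p \<in> N \<and> (\<forall>q\<in>N. h q = f i q)" if "i \<in> I" for i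
    by (rule smooth_at_extends[OF f[OF that]]) blast
  then obtain h N where h: "\<And>i. i \<in> I \<Longrightarrow> h i \<in> C"
    and N: "\<And>i. i \<in> I \<Longrightarrow> openin M (N i)" "\<And>i. i \<in> I \<Longrightarrow> p \<in> N i"
    and eq: "\<And>i q. i \<in> I \<Longrightarrow> q \<in> N i \<Longrightarrow> h i q = f i q"
    by metis
  show ?thesis
  proof (rule that[of h "topspace M \<inter> (\<Inter>i\<in>I. N i)"])
    show "openin M (topspace M \<inter> (\<Inter>i\<in>I. N i))"
      using openin_INT[OF I, of M N] N(1) by (simp add: Int_commute)
  qed (use p h N(2) eq in auto)
qed

end

section \<open>Vector fields as derivations\<close>

lemma sum_fun_apply: "(\<Sum>i\<in>I. f i) p = (\<Sum>i\<in>I. f i p)"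
  for f :: "'i \<Rightarrow> 'b \<Rightarrow> 'c::comm_monoid_add"
  by (induction I rule: infinite_finite_induct) auto

lemma additive_uminus:
  fixes T :: "'b::ab_group_add \<Rightarrow> 'c::ab_group_add"
  assumes add: "\<And>x y. x \<in> S \<Longrightarrow> y \<in> S \<Longrightarrow> T (x + y) = T x + T y"
    and S: "0 \<in> S" "x \<in> S" "- x \<in> S"
  shows "T (- x) = - T x"
proof -
  have "T 0 = 0" using add[OF S(1,1)] by simp
  then show ?thesis using add[OF S(2,3)] by (simp add: minus_unique)
qed

context manifold
begin

abbreviation "\<X> \<equiv> vector_fields M A"

lemma vfield:
  assumes "X \<in> \<X>"
  shows vfield_outside: "f \<notin> C \<Longrightarrow> X f = 0"
    and vfield_C: "f \<in> C \<Longrightarrow> X f \<in> C"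
    and vfield_plus: "f \<in> C \<Longrightarrow> h \<in> C \<Longrightarrow> X (f + h) = X f + X h"
    and vfield_scale: "f \<in> C \<Longrightarrow> X ((\<lambda>_. a) * f) = (\<lambda>_. a) * X f"
    and vfield_mult: "f \<in> C \<Longrightarrow> h \<in> C \<Longrightarrow> X (f * h) = X f * h + f * X h"
  using assms by (auto simp: vector_fields_def)

lemma vfieldI:
  assumes "\<And>f. f \<notin> C \<Longrightarrow> X f = 0" "\<And>f. f \<in> C \<Longrightarrow> X f \<in> C"
    and "\<And>f h. f \<in> C \<Longrightarrow> h \<in> C \<Longrightarrow> X (f + h) = X f + X h"
    and "\<And>f a. f \<in> C \<Longrightarrow> X ((\<lambda>_. a) * f) = (\<lambda>_. a) * X f"
    and "\<And>f h. f \<in> C \<Longrightarrow> h \<in> C \<Longrightarrow> X (f * h) = X f * h + f * X h"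
  shows "X \<in> \<X>"
  using assms by (auto simp: vector_fields_def)

lemma vfield_add:
  assumes "X \<in> \<X>" "Y \<in> \<X>"
  shows "X + Y \<in> \<X>"
proof (rule vfieldI)
  show "(X + Y) f = 0" if "f \<notin> C" for f
    by (simp only: plus_fun_apply vfield_outside[OF _ that] assms add_0_left)
  fix f assume f: "f \<in> C"
  show "(X + Y) f \<in> C" using f by (simp add: C_add vfield_C assms)
  show "(X + Y) ((\<lambda>_. a) * f) = (\<lambda>_. a) * (X + Y) f" for a
    by (simp only: plus_fun_apply vfield_scale[OF _ f] assms distrib_left)
  fix h assume h: "h \<in> C"
  show "(X + Y) (f + h) = (X + Y) f + (X + Y) h"
    by (rule ext) (simp add: vfield_plus[OF assms(1) f h] vfield_plus[OF assms(2) f h])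
  show "(X + Y) (f * h) = (X + Y) f * h + f * (X + Y) h"
    by (rule ext) (simp add: vfield_mult[OF assms(1) f h] vfield_mult[OF assms(2) f h] algebra_simps)
qed

lemma vfield_fmult_closed:
  assumes "X \<in> \<X>" "\<And>h. h \<in> C \<Longrightarrow> f * h \<in> C"
  shows "f \<cdot>\<^sub>F X \<in> \<X>"
proof (rule vfieldI)
  show "(f \<cdot>\<^sub>F X) h = 0" if "h \<notin> C" for h
    by (simp only: fmult_def vfield_outside[OF assms(1) that] mult_zero_right)
  fix h assume h: "h \<in> C"
  show "(f \<cdot>\<^sub>F X) h \<in> C" unfolding fmult_def by (rule assms(2)[OF vfield_C[OF assms(1) h]])
  show "(f \<cdot>\<^sub>F X) ((\<lambda>_. a) * h) = (\<lambda>_. a) * (f \<cdot>\<^sub>F X) h" for a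
    by (rule ext) (simp add: fmult_def vfield_scale[OF assms(1) h])
  fix k assume k: "k \<in> C"
  show "(f \<cdot>\<^sub>F X) (h + k) = (f \<cdot>\<^sub>F X) h + (f \<cdot>\<^sub>F X) k"
    by (rule ext) (simp add: fmult_def vfield_plus[OF assms(1) h k] algebra_simps)
  show "(f \<cdot>\<^sub>F X) (h * k) = (f \<cdot>\<^sub>F X) h * k + h * (f \<cdot>\<^sub>F X) k"
    by (rule ext) (simp add: fmult_def vfield_mult[OF assms(1) h k] algebra_simps)
qed

lemma vfield_fmult: "f \<in> C \<Longrightarrow> X \<in> \<X> \<Longrightarrow> f \<cdot>\<^sub>F X \<in> \<X>"
  by (rule vfield_fmult_closed) (auto intro: C_mult)

lemma vfield_scale_closed: "X \<in> \<X> \<Longrightarrow> (\<lambda>_. a) \<cdot>\<^sub>F X \<in> \<X>"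
  by (rule vfield_fmult_closed) (auto intro: C_scale)

lemma vfield_zero: "0 \<in> \<X>"
  by (rule vfieldI) (simp_all add: C_zero)

lemma vfield_sum: "(\<And>i. i \<in> I \<Longrightarrow> X i \<in> \<X>) \<Longrightarrow> sum X I \<in> \<X>"
  by (induction I rule: infinite_finite_induct) (auto intro: vfield_add vfield_zero)

lemma vfield_apply_zero: "X \<in> \<X> \<Longrightarrow> X 0 = 0"
  using vfield_plus[of X 0 0] C_zero by simp

lemma vfield_apply_sum:
  assumes "X \<in> \<X>" "\<And>i. i \<in> I \<Longrightarrow> f i \<in> C"
  shows "X (sum f I) = (\<Sum>i\<in>I. X (f i))"
  using assms(2)
proof (induction I rule: infinite_finite_induct)
  case (insert i I)
  have "f i \<in> C" "sum f I \<in> C" using insert.prems by (auto intro: C_sum)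
  moreover have "X (sum f I) = (\<Sum>i\<in>I. X (f i))" by (rule insert.IH) (simp add: insert.prems)
  ultimately show ?case by (simp only: sum.insert[OF insert.hyps] vfield_plus[OF assms(1)])
qed (simp_all only: sum.infinite sum.empty vfield_apply_zero[OF assms(1)] not_False_eq_True)

lemma vfield_uminus:
  assumes "X \<in> \<X>"
  shows "- X \<in> \<X>"
proof -
  have "- X = (\<lambda>_. - 1) \<cdot>\<^sub>F X" by (simp add: fmult_def fun_eq_iff)
  then show ?thesis using vfield_scale_closed[OF assms] by simp
qed

lemma vfield_apply_const:
  assumes "X \<in> \<X>"
  shows "X (const_fun a) = 0"
proof -
  have one_mult: "const_fun 1 * f = f" if "f \<in> C" for f
    using smooth_function_outside[OF that] by (auto simp: const_fun_def)
  have "X (const_fun 1 * const_fun 1) = X (const_fun 1) + X (const_fun 1)"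
    using vfield_mult[OF assms const_fun_smooth const_fun_smooth]
      one_mult[OF vfield_C[OF assms const_fun_smooth]]
    by (simp add: mult.commute)
  then have "X (const_fun 1) = 0" by (simp add: one_mult[OF const_fun_smooth])
  moreover have "(\<lambda>_. a) * const_fun 1 = const_fun a" by (auto simp: const_fun_def)
  ultimately show ?thesis using vfield_scale[OF assms const_fun_smooth[of 1], of a] by simp
qed

lemma vfield_local:
  assumes X: "X \<in> \<X>" and f: "f \<in> C" and h: "h \<in> C"
    and W: "openin M W" "p \<in> W" "\<And>q. q \<in> W \<Longrightarrow> f q = h q"
  shows "X f p = X h p"
proof -
  obtain \<beta> where \<beta>: "\<beta> \<in> C" "\<beta> p = 1" "\<And>q. q \<notin> W \<Longrightarrow> \<beta> q = 0"
    by (rule bump_at_point[OF W(1,2)]) blast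
  have "\<beta> * f = \<beta> * h"
  proof
    show "(\<beta> * f) q = (\<beta> * h) q" for q using \<beta>(3)[of q] W(3)[of q] by (cases "q \<in> W") auto
  qed
  then have "X (\<beta> * f) p = X (\<beta> * h) p" by simp
  then show ?thesis
    using W(2,3) \<beta>(2) by (simp add: vfield_mult[OF X \<beta>(1)] f h)
qed

definition C_linear :: "('a vfield \<Rightarrow> 'a sfun) \<Rightarrow> bool" where
  "C_linear T \<longleftrightarrow> (\<forall>X\<in>\<X>. \<forall>Y\<in>\<X>. T (X + Y) = T X + T Y) \<and> (\<forall>f\<in>C. \<forall>X\<in>\<X>. T (f \<cdot>\<^sub>F X) = f * T X)"

lemma C_linear_add: "C_linear T \<Longrightarrow> X \<in> \<X> \<Longrightarrow> Y \<in> \<X> \<Longrightarrow> T (X + Y) = T X + T Y"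
  by (simp add: C_linear_def)

lemma C_linear_fmult: "C_linear T \<Longrightarrow> f \<in> C \<Longrightarrow> X \<in> \<X> \<Longrightarrow> T (f \<cdot>\<^sub>F X) = f * T X"
  by (simp add: C_linear_def)

lemma C_linear_zero: "C_linear T \<Longrightarrow> T 0 = 0"
  using C_linear_add[of T 0 0] vfield_zero by simp

lemma C_linear_uminus: "C_linear T \<Longrightarrow> X \<in> \<X> \<Longrightarrow> T (- X) = - T X"
  by (rule additive_uminus[where S = \<X>]) (blast intro: C_linear_add vfield_zero vfield_uminus)+

lemma C_linear_sum:
  assumes T: "C_linear T" and "\<And>i. i \<in> I \<Longrightarrow> f i \<in> C" "\<And>i. i \<in> I \<Longrightarrow> X i \<in> \<X>"
  shows "T (\<Sum>i\<in>I. f i \<cdot>\<^sub>F X i) = (\<Sum>i\<in>I. f i * T (X i))"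
  using assms(2,3)
proof (induction I rule: infinite_finite_induct)
  case (insert i I)
  have "f i \<cdot>\<^sub>F X i \<in> \<X>" by (intro vfield_fmult insert.prems) simp_all
  moreover have "(\<Sum>i\<in>I. f i \<cdot>\<^sub>F X i) \<in> \<X>" by (intro vfield_sum vfield_fmult insert.prems) simp_all
  ultimately have "T (f i \<cdot>\<^sub>F X i + (\<Sum>i\<in>I. f i \<cdot>\<^sub>F X i)) = T (f i \<cdot>\<^sub>F X i) + T (\<Sum>i\<in>I. f i \<cdot>\<^sub>F X i)"
    by (rule C_linear_add[OF T])
  moreover have "T (f i \<cdot>\<^sub>F X i) = f i * T (X i)"
    by (intro C_linear_fmult T insert.prems) simp_all
  moreover have "T (\<Sum>i\<in>I. f i \<cdot>\<^sub>F X i) = (\<Sum>i\<in>I. f i * T (X i))"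
    by (rule insert.IH) (use insert.prems in auto)
  ultimately show ?case by (simp only: sum.insert[OF insert.hyps])
qed (simp_all add: C_linear_zero[OF T])

lemma C_linear_local:
  assumes T: "C_linear T" and X: "X \<in> \<X>" and Y: "Y \<in> \<X>" and W: "openin M W" "p \<in> W"
    and eq: "\<And>f q. f \<in> C \<Longrightarrow> q \<in> W \<Longrightarrow> X f q = Y f q"
  shows "T X p = T Y p"
proof -
  obtain \<beta> where \<beta>: "\<beta> \<in> C" "\<beta> p = 1" "\<And>q. q \<notin> W \<Longrightarrow> \<beta> q = 0"
    by (rule bump_at_point[OF W]) blast
  have "\<beta> \<cdot>\<^sub>F X = \<beta> \<cdot>\<^sub>F Y"
  proof (intro ext)
    show "(\<beta> \<cdot>\<^sub>F X) f q = (\<beta> \<cdot>\<^sub>F Y) f q" for f q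
    proof (cases "f \<in> C")
      case True
      then show ?thesis using \<beta>(3)[of q] eq[of f q] by (cases "q \<in> W") (auto simp: fmult_def)
    qed (simp add: fmult_def vfield_outside X Y)
  qed
  then have "\<beta> * T X = \<beta> * T Y"
    using C_linear_fmult[OF T \<beta>(1)] X Y by metis
  then have "(\<beta> * T X) p = (\<beta> * T Y) p" by simp
  then show ?thesis using \<beta>(2) by simp
qed

subsection \<open>Partial derivatives in a chart\<close>

definition chart_partial :: "'a set \<Rightarrow> ('a \<Rightarrow> 'e) \<Rightarrow> 'e \<Rightarrow> 'a sfun \<Rightarrow> 'a sfun" where
  "chart_partial U c b f = (\<lambda>q. frechet_derivative (f \<circ> inv_into U c) (at (c q)) b)"

lemma has_derivative_chart_partial:
  assumes "f \<in> C" "(U, c) \<in> A" "q \<in> U"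
  shows "(f \<circ> inv_into U c has_derivative (\<lambda>b. chart_partial U c b f q)) (at (c q))"
  unfolding chart_partial_def
  using smooth_on_has_derivative[OF smooth_function_in_chart[OF assms(1,2)]] assms(3) by simp

lemma chart_partial_eqI:
  "(f \<circ> inv_into U c has_derivative f') (at (c q)) \<Longrightarrow> chart_partial U c b f q = f' b"
  unfolding chart_partial_def by (metis frechet_derivative_at)

lemma smooth_at_chart_partial:
  assumes f: "f \<in> C" and U: "(U, c) \<in> A" "q \<in> U"
  shows "smooth_at (chart_partial U c b f) q"
  by (rule smooth_atI[OF U(1) chart_openin[OF U(1)] U(2) order_refl
        smooth_on_frechet_derivative[OF smooth_function_in_chart[OF f U(1)]]])
    (simp add: chart_partial_def)

lemma chart_partial_coordinate:
  assumes U: "(U, c) \<in> A" and N: "openin M N" "N \<subseteq> U" "q \<in> N" "\<And>r. r \<in> N \<Longrightarrow> x r = c r \<bullet> b'"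
  shows "chart_partial U c b x q = b \<bullet> b'"
proof (rule chart_partial_eqI)
  have "((\<lambda>y. y \<bullet> b') has_derivative (\<lambda>y. y \<bullet> b')) (at (c q))"
    by (rule bounded_linear_imp_has_derivative[OF bounded_linear_inner_left])
  then show "(x \<circ> inv_into U c has_derivative (\<lambda>y. y \<bullet> b')) (at (c q))"
    by (rule has_derivative_transform_within_open[OF _ chart_image_open[OF U N(1,2)]])
      (use N chart_inv[OF U] in auto)
qed

context
  fixes U c q
  assumes U: "(U, c) \<in> A" "q \<in> U"
begin

lemma chart_partial_scale:
  assumes "f \<in> C"
  shows "chart_partial U c b ((\<lambda>_. a) * f) q = a * chart_partial U c b f q"
  by (rule chart_partial_eqI)
    (use has_derivative_mult_right[OF has_derivative_chart_partial[OF assms U]] in \<open>simp add: o_def\<close>)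

lemma chart_partial_add:
  assumes "f \<in> C" "h \<in> C"
  shows "chart_partial U c b (f + h) q = chart_partial U c b f q + chart_partial U c b h q"
  by (rule chart_partial_eqI)
    (use has_derivative_add[OF assms[THEN has_derivative_chart_partial, OF U]] in \<open>simp add: o_def\<close>)

lemma chart_partial_mult:
  assumes "f \<in> C" "h \<in> C"
  shows "chart_partial U c b (f * h) q = f q * chart_partial U c b h q + chart_partial U c b f q * h q"
  by (rule chart_partial_eqI)
    (use has_derivative_mult[OF assms[THEN has_derivative_chart_partial, OF U]] in
      \<open>simp add: o_def chart_inv[OF U]\<close>)

end

text \<open>Off \<open>U\<close> the values of \<open>chart_partial\<close> are junk; multiplying by a function supported in \<open>U\<close> removes
  them.\<close>

definition cutoff_partial :: "'a sfun \<Rightarrow> 'a set \<Rightarrow> ('a \<Rightarrow> 'e) \<Rightarrow> 'e \<Rightarrow> 'a vfield" where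
  "cutoff_partial \<beta> U c b f = (if f \<in> C then \<beta> * chart_partial U c b f else 0)"

lemma cutoff_partial_vector_field:
  assumes U: "(U, c) \<in> A" and \<beta>: "\<beta> \<in> C" "\<And>q. q \<notin> K \<Longrightarrow> \<beta> q = 0" and K: "closedin M K" "K \<subseteq> U"
  shows "cutoff_partial \<beta> U c b \<in> \<X>"
proof (rule vfieldI)
  have \<beta>_U: "\<beta> q = 0" if "q \<notin> U" for q using \<beta>(2) K(2) that by blast
  show "cutoff_partial \<beta> U c b f = 0" if "f \<notin> C" for f using that by (simp add: cutoff_partial_def)
  fix f assume f: "f \<in> C"
  show "cutoff_partial \<beta> U c b f \<in> C"
    using cutoff_mult_smooth[OF chart_openin[OF U] K \<beta> smooth_at_chart_partial[OF f U]] f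
    by (simp add: cutoff_partial_def)
  show "cutoff_partial \<beta> U c b ((\<lambda>_. a) * f) = (\<lambda>_. a) * cutoff_partial \<beta> U c b f" for a
  proof
    show "cutoff_partial \<beta> U c b ((\<lambda>_. a) * f) q = ((\<lambda>_. a) * cutoff_partial \<beta> U c b f) q" for q
      using f by (cases "q \<in> U") (simp_all add: cutoff_partial_def C_scale chart_partial_scale[OF U] \<beta>_U)
  qed
  fix h assume h: "h \<in> C"
  show "cutoff_partial \<beta> U c b (f + h) = cutoff_partial \<beta> U c b f + cutoff_partial \<beta> U c b h"
  proof
    show "cutoff_partial \<beta> U c b (f + h) q = (cutoff_partial \<beta> U c b f + cutoff_partial \<beta> U c b h) q" for q
      using f h by (cases "q \<in> U")
        (simp_all add: cutoff_partial_def C_add chart_partial_add[OF U] \<beta>_U distrib_left)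
  qed
  show "cutoff_partial \<beta> U c b (f * h) = cutoff_partial \<beta> U c b f * h + f * cutoff_partial \<beta> U c b h"
  proof
    show "cutoff_partial \<beta> U c b (f * h) q =
        (cutoff_partial \<beta> U c b f * h + f * cutoff_partial \<beta> U c b h) q" for q
      using f h by (cases "q \<in> U")
        (simp_all add: cutoff_partial_def C_mult chart_partial_mult[OF U] \<beta>_U algebra_simps)
  qed
qed

subsection \<open>Local frames\<close>

lemma hadamard_in_chart:
  assumes U: "(U, c) \<in> A" "q \<in> U" and f: "f \<in> C"
  obtains N H where "openin M N" "q \<in> N" "N \<subseteq> U" "\<And>b. b \<in> Basis \<Longrightarrow> H b \<in> C"
    "\<And>b. b \<in> Basis \<Longrightarrow> H b q = chart_partial U c b f q"
    "\<And>s. s \<in> N \<Longrightarrow> f s = f q + (\<Sum>b\<in>Basis. ((c s - c q) \<bullet> b) * H b s)"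
proof -
  obtain r where r: "r > 0" "ball (c q) r \<subseteq> c ` U"
    using chart_open_image[OF U(1)] U(2) by (meson imageI open_contains_ball)
  obtain h where h: "\<And>b. smooth_on (ball (c q) r) (h b)"
    "\<And>b. h b (c q) = frechet_derivative (f \<circ> inv_into U c) (at (c q)) b"
    and h_eq: "\<And>y. y \<in> ball (c q) r \<Longrightarrow> (f \<circ> inv_into U c) y =
      (f \<circ> inv_into U c) (c q) + (\<Sum>b\<in>Basis. ((y - c q) \<bullet> b) *\<^sub>R h b y)"
    by (rule hadamard[OF open_ball convex_ball _
          smooth_on_subset[OF smooth_function_in_chart[OF f U(1)] r(2)]])
      (use r(1) in auto)
  define W where "W = {s \<in> U. c s \<in> ball (c q) r}"
  have W: "openin M W" "q \<in> W" "W \<subseteq> U"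
    using chart_vimage_openin[OF U(1) open_ball, of "c q" r] r(1) U(2) by (auto simp: W_def)
  have "smooth_at (\<lambda>s. h b (c s)) q" for b
    by (rule smooth_atI[OF U(1) W smooth_on_subset[OF h(1)]]) (auto simp: W_def)
  then obtain H N where H: "\<And>b. b \<in> Basis \<Longrightarrow> H b \<in> C" and N: "openin M N" "q \<in> N"
    and H_eq: "\<And>b s. b \<in> Basis \<Longrightarrow> s \<in> N \<Longrightarrow> H b s = h b (c s)"
    using smooth_at_extends_finite[OF finite_Basis, of q "\<lambda>b s. h b (c s)"]
      subsetD[OF openin_subset[OF W(1)] W(2)] by metis
  show ?thesis
  proof (rule that[OF openin_Int[OF W(1) N(1)]])
    show "H b q = chart_partial U c b f q" if "b \<in> Basis" for b
      by (simp add: H_eq[OF that N(2)] h(2) chart_partial_def)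
    show "f s = f q + (\<Sum>b\<in>Basis. ((c s - c q) \<bullet> b) * H b s)" if "s \<in> W \<inter> N" for s
      using h_eq[of "c s"] that by (auto simp: W_def H_eq chart_inv[OF U(1)] U(2))
  qed (use W N H in auto)
qed

lemma vfield_chart_expansion:
  assumes U: "(U, c) \<in> A" "q \<in> U" and Y: "Y \<in> \<X>" and f: "f \<in> C" and N: "openin M N" "q \<in> N"
    and x: "\<And>b. b \<in> Basis \<Longrightarrow> x b \<in> C" "\<And>b r. b \<in> Basis \<Longrightarrow> r \<in> N \<Longrightarrow> x b r = c r \<bullet> b"
  shows "Y f q = (\<Sum>b\<in>Basis. Y (x b) q * chart_partial U c b f q)"
proof -
  obtain N' H where N': "openin M N'" "q \<in> N'" and H: "\<And>b. b \<in> Basis \<Longrightarrow> H b \<in> C"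
    and H_q: "\<And>b. b \<in> Basis \<Longrightarrow> H b q = chart_partial U c b f q"
    and taylor: "\<And>s. s \<in> N' \<Longrightarrow> f s = f q + (\<Sum>b\<in>Basis. ((c s - c q) \<bullet> b) * H b s)"
    by (rule hadamard_in_chart[OF U f]) blast
  define y where "y b = x b + const_fun (- (c q \<bullet> b))" for b
  have y: "y b \<in> C" if "b \<in> Basis" for b
    unfolding y_def by (intro C_add x(1) const_fun_smooth that)
  have y_eq: "y b s = (c s - c q) \<bullet> b" if "b \<in> Basis" "s \<in> N" for b s
    using that openin_subset[OF N(1)] x(2) by (auto simp: y_def const_fun_apply inner_diff_left)
  have Y_y: "Y (y b) = Y (x b)" if "b \<in> Basis" for b
    unfolding y_def vfield_plus[OF Y x(1)[OF that] const_fun_smooth] by (simp add: vfield_apply_const[OF Y])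
  have yH: "y b * H b \<in> C" if "b \<in> Basis" for b by (intro C_mult y H that)
  have sum_yH: "(\<Sum>b\<in>Basis. y b * H b) \<in> C" by (rule C_sum) (rule yH)
  define R where "R = const_fun (f q) + (\<Sum>b\<in>Basis. y b * H b)"
  have R: "R \<in> C" unfolding R_def by (rule C_add[OF const_fun_smooth sum_yH])
  have "Y f q = Y R q"
  proof (rule vfield_local[OF Y f R openin_Int[OF N(1) N'(1)]])
    show "f s = R s" if "s \<in> N \<inter> N'" for s
      using that openin_subset[OF N(1)]
      by (auto simp: taylor[of s] R_def sum_fun_apply const_fun_apply y_eq)
  qed (use N N' in simp)
  also have "\<dots> = (\<Sum>b\<in>Basis. Y (y b * H b) q)"
    unfolding R_def vfield_plus[OF Y const_fun_smooth sum_yH]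
    by (simp add: vfield_apply_const[OF Y] vfield_apply_sum[OF Y yH] sum_fun_apply)
  also have "\<dots> = (\<Sum>b\<in>Basis. Y (x b) q * chart_partial U c b f q)"
    by (rule sum.cong) (simp_all add: vfield_mult[OF Y y H] Y_y H_q y_eq N(2))
  finally show ?thesis .
qed

definition local_frame :: "'a set \<Rightarrow> ('e \<Rightarrow> 'a vfield) \<Rightarrow> ('e \<Rightarrow> 'a sfun) \<Rightarrow> bool" where
  "local_frame N E x \<longleftrightarrow> openin M N \<and> (\<forall>b\<in>Basis. E b \<in> \<X> \<and> x b \<in> C) \<and>
     (\<forall>b\<in>Basis. \<forall>b'\<in>Basis. \<forall>q\<in>N. E b (x b') q = (if b = b' then 1 else 0)) \<and>
     (\<forall>Y\<in>\<X>. \<forall>f\<in>C. \<forall>q\<in>N. Y f q = (\<Sum>b\<in>Basis. Y (x b) q * E b f q))"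

lemma local_frameD:
  assumes "local_frame N E x"
  shows local_frame_openin: "openin M N"
    and local_frame_vector_field: "b \<in> Basis \<Longrightarrow> E b \<in> \<X>"
    and local_frame_smooth: "b \<in> Basis \<Longrightarrow> x b \<in> C"
    and local_frame_dual:
      "b \<in> Basis \<Longrightarrow> b' \<in> Basis \<Longrightarrow> q \<in> N \<Longrightarrow> E b (x b') q = (if b = b' then 1 else 0)"
    and local_frame_expansion:
      "Y \<in> \<X> \<Longrightarrow> f \<in> C \<Longrightarrow> q \<in> N \<Longrightarrow> Y f q = (\<Sum>b\<in>Basis. Y (x b) q * E b f q)"
  using assms unfolding local_frame_def by blast+

lemma local_frame_exists:
  assumes "p \<in> topspace M"
  obtains N E x where "p \<in> N" "local_frame N E x"
proof -
  obtain U c where U: "(U, c) \<in> A" "p \<in> U" using assms by (rule chart_ex)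
  obtain \<beta> N K where \<beta>: "\<beta> \<in> C" and N: "openin M N" "p \<in> N" "N \<subseteq> U" and K: "closedin M K" "K \<subseteq> U"
    and \<beta>_1: "\<And>q. q \<in> N \<Longrightarrow> \<beta> q = 1" and \<beta>_0: "\<And>q. q \<notin> K \<Longrightarrow> \<beta> q = 0"
    by (rule bump_exists[OF chart_openin[OF U(1)] U(2)]) blast
  define x where "x b = \<beta> * (\<lambda>q. c q \<bullet> b)" for b
  let ?E = "cutoff_partial \<beta> U c"
  have x: "x b \<in> C" for b
    unfolding x_def
    by (rule cutoff_mult_smooth[OF chart_openin[OF U(1)] K \<beta> \<beta>_0 smooth_at_chart_coordinate[OF U(1)]])
  have x_eq: "x b q = c q \<bullet> b" if "q \<in> N" for b q using \<beta>_1[OF that] by (simp add: x_def)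
  have E_eq: "?E b f q = chart_partial U c b f q" if "f \<in> C" "q \<in> N" for b f q
    using that by (simp add: cutoff_partial_def \<beta>_1)
  have "local_frame N ?E x"
    unfolding local_frame_def
  proof (intro conjI ballI)
    show "?E b (x b') q = (if b = b' then 1 else 0)" if "b \<in> Basis" "b' \<in> Basis" "q \<in> N" for b b' q
      using chart_partial_coordinate[OF U(1) N(1,3) that(3) x_eq] that by (simp add: E_eq x inner_Basis)
    show "Y f q = (\<Sum>b\<in>Basis. Y (x b) q * ?E b f q)" if "Y \<in> \<X>" "f \<in> C" "q \<in> N" for Y f q
      using vfield_chart_expansion[OF U(1) subsetD[OF N(3) that(3)] that(1,2) N(1) that(3) x x_eq] that
      by (simp add: E_eq)
  qed (use N x cutoff_partial_vector_field[OF U(1) \<beta> \<beta>_0 K] in auto)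
  with N(2) show ?thesis by (rule that)
qed

lemma C_linear_frame_expansion:
  assumes frame: "local_frame N E x" and T: "C_linear T" and Y: "Y \<in> \<X>" and q: "q \<in> N"
  shows "T Y q = (\<Sum>b\<in>Basis. Y (x b) q * T (E b) q)"
proof -
  have Yx: "Y (x b) \<in> C" if "b \<in> Basis" for b
    by (rule vfield_C[OF Y local_frame_smooth[OF frame that]])
  define Z where "Z = (\<Sum>b\<in>Basis. Y (x b) \<cdot>\<^sub>F E b)"
  have Z: "Z \<in> \<X>"
    unfolding Z_def by (intro vfield_sum vfield_fmult Yx local_frame_vector_field[OF frame])
  have "T Y q = T Z q"
  proof (rule C_linear_local[OF T Y Z local_frame_openin[OF frame] q])
    show "Y f r = Z f r" if "f \<in> C" "r \<in> N" for f r
      using local_frame_expansion[OF frame Y that] by (simp add: Z_def sum_fun_apply fmult_def)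
  qed
  also have "T Z = (\<Sum>b\<in>Basis. Y (x b) * T (E b))"
    unfolding Z_def by (rule C_linear_sum[OF T Yx local_frame_vector_field[OF frame]])
  finally show ?thesis by (simp add: sum_fun_apply)
qed

end

section \<open>The musical isomorphism\<close>

context manifold
begin

lemma vfield_glue:
  assumes N: "\<And>p. p \<in> topspace M \<Longrightarrow> openin M (N p)" "\<And>p. p \<in> topspace M \<Longrightarrow> p \<in> N p"
    and L: "\<And>p. p \<in> topspace M \<Longrightarrow> L p \<in> \<X>"
    and compatible: "\<And>f p q. f \<in> C \<Longrightarrow> p \<in> topspace M \<Longrightarrow> q \<in> N p \<Longrightarrow> L q f q = L p f q"
  obtains X where "X \<in> \<X>" "\<And>f p q. f \<in> C \<Longrightarrow> p \<in> topspace M \<Longrightarrow> q \<in> N p \<Longrightarrow> X f q = L p f q"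
proof -
  define X where "X f q = (if f \<in> C \<and> q \<in> topspace M then L q f q else 0)" for f q
  have X_L: "X f q = L p f q" if "f \<in> C" "p \<in> topspace M" "q \<in> N p" for f p q
    using compatible[OF that] that openin_subset[OF N(1)[OF that(2)]] by (auto simp: X_def)
  have "X \<in> \<X>"
  proof (rule vfieldI)
    show "X f = 0" if "f \<notin> C" for f using that by (simp add: X_def fun_eq_iff)
    fix f assume f: "f \<in> C"
    have "smooth_at (X f) p" if p: "p \<in> topspace M" for p
      by (rule smooth_at_cong[OF N(1,2)[OF p] X_L[OF f p]
            smooth_function_smooth_at[OF vfield_C[OF L[OF p] f] p]])
    then show "X f \<in> C" by (simp add: smooth_functions_iff X_def)
    show "X ((\<lambda>_. a) * f) = (\<lambda>_. a) * X f" for a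
      by (rule ext) (simp add: X_def f C_scale vfield_scale[OF L f])
    fix h assume h: "h \<in> C"
    show "X (f + h) = X f + X h"
      by (rule ext) (simp add: X_def f h C_add vfield_plus[OF L f h])
    show "X (f * h) = X f * h + f * X h"
      by (rule ext) (simp add: X_def f h C_mult vfield_mult[OF L f h])
  qed
  then show ?thesis using X_L by (rule that)
qed

abbreviation "\<Omega> \<equiv> one_forms M A"

lemma one_form_C: "\<xi> \<in> \<Omega> \<Longrightarrow> X \<in> \<X> \<Longrightarrow> \<xi> X \<in> C"
  by (simp add: one_forms_def)

lemma one_form_C_linear: "\<xi> \<in> \<Omega> \<Longrightarrow> C_linear \<xi>"
  by (simp add: one_forms_def C_linear_def)

lemma one_form_outside: "\<xi> \<in> \<Omega> \<Longrightarrow> X \<notin> \<X> \<Longrightarrow> \<xi> X = 0"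
  by (simp add: one_forms_def)

lemma one_formI:
  assumes "\<And>X. X \<notin> \<X> \<Longrightarrow> \<xi> X = 0" "\<And>X. X \<in> \<X> \<Longrightarrow> \<xi> X \<in> C" "C_linear \<xi>"
  shows "\<xi> \<in> \<Omega>"
  using assms by (simp add: one_forms_def C_linear_def)

end

locale nondegenerate_form = manifold M A
  for M :: "'a topology" and A :: "('a, 'e::euclidean_space) chart set" +
  fixes b :: "'a vfield \<Rightarrow> 'a vfield \<Rightarrow> 'a sfun"
  assumes bilinear: "bilinear_form M A b" and nondegenerate: "nondegenerate M A b"
begin

lemma form_C: "X \<in> \<X> \<Longrightarrow> Y \<in> \<X> \<Longrightarrow> b X Y \<in> C"
  using bilinear by (simp add: bilinear_form_def)

lemma form_C_linear_right: "X \<in> \<X> \<Longrightarrow> C_linear (b X)"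
  and form_C_linear_left: "Y \<in> \<X> \<Longrightarrow> C_linear (\<lambda>X. b X Y)"
  using bilinear by (simp_all add: bilinear_form_def C_linear_def)

lemma vfield_eq_at:
  assumes X: "X \<in> \<X>" and Y: "Y \<in> \<X>" and p: "p \<in> topspace M"
    and eq: "\<And>Z. Z \<in> \<X> \<Longrightarrow> b X Z p = b Y Z p" and f: "f \<in> C"
  shows "X f p = Y f p"
proof -
  define W where "W = X + - Y"
  have W: "W \<in> \<X>" unfolding W_def by (intro vfield_add vfield_uminus X Y)
  have "b W Z p = 0" if Z: "Z \<in> \<X>" for Z
  proof -
    note linear = form_C_linear_left[OF Z]
    have "b W Z = b X Z + - b Y Z"
      unfolding W_def C_linear_add[OF linear X vfield_uminus[OF Y]] C_linear_uminus[OF linear Y] ..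
    then show ?thesis by (simp add: eq[OF Z])
  qed
  then have "W f p = 0" using nondegenerate p W f unfolding nondegenerate_def by blast
  then show ?thesis by (simp add: W_def)
qed

lemma vfield_eqI:
  assumes X: "X \<in> \<X>" and Y: "Y \<in> \<X>" and eq: "\<And>Z. Z \<in> \<X> \<Longrightarrow> b X Z = b Y Z"
  shows "X = Y"
proof (intro ext)
  fix f p
  consider (outside) "f \<notin> C" | (inside) "f \<in> C" "p \<in> topspace M" | (off) "f \<in> C" "p \<notin> topspace M" by blast
  then show "X f p = Y f p"
  proof cases
    case outside
    show ?thesis by (simp add: vfield_outside[OF X outside] vfield_outside[OF Y outside])
  next
    case inside
    show ?thesis by (rule vfield_eq_at[OF X Y inside(2) _ inside(1)]) (simp add: eq)
  next
    case off
    then show ?thesis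
      using smooth_function_outside[OF vfield_C[OF X]] smooth_function_outside[OF vfield_C[OF Y]] by metis
  qed
qed

lemma gram_injective:
  assumes frame: "local_frame N E x" and p: "p \<in> N"
    and ker: "\<And>i. i \<in> Basis \<Longrightarrow> (\<Sum>k\<in>Basis. b (E k) (E i) p * v k) = 0" and j: "j \<in> Basis"
  shows "v j = 0"
proof -
  note E = local_frame_vector_field[OF frame]
  have p_M: "p \<in> topspace M" using openin_subset[OF local_frame_openin[OF frame]] p by blast
  define Z where "Z = (\<Sum>k\<in>Basis. const_fun (v k) \<cdot>\<^sub>F E k)"
  have Z: "Z \<in> \<X>" unfolding Z_def by (intro vfield_sum vfield_fmult const_fun_smooth E)
  have "b Z (E i) p = 0" if "i \<in> Basis" for i
  proof -
    have "b Z (E i) = (\<Sum>k\<in>Basis. const_fun (v k) * b (E k) (E i))"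
      unfolding Z_def by (rule C_linear_sum[OF form_C_linear_left[OF E[OF that]] const_fun_smooth E])
    then show ?thesis
      using ker[OF that] by (simp add: sum_fun_apply const_fun_apply[OF p_M] mult.commute)
  qed
  then have "b Z Y p = 0" if "Y \<in> \<X>" for Y
    using C_linear_frame_expansion[OF frame form_C_linear_right[OF Z] that p] by simp
  then have "Z (x j) p = 0"
    using nondegenerate p_M Z local_frame_smooth[OF frame j] unfolding nondegenerate_def by blast
  moreover have "Z (x j) p = (\<Sum>k\<in>Basis. v k * (if k = j then 1 else 0))"
    using local_frame_dual[OF frame _ j p]
    by (simp add: Z_def sum_fun_apply fmult_def const_fun_apply[OF p_M])
  ultimately show ?thesis using j by (simp add: if_distrib cong: if_cong)
qed

lemma gram_system_solvable:
  assumes frame: "local_frame N E x" and p: "p \<in> N" and \<xi>: "\<xi> \<in> \<Omega>"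
  obtains a W where "\<And>j. j \<in> Basis \<Longrightarrow> a j \<in> C" "openin M W" "p \<in> W"
    "\<And>i q. i \<in> Basis \<Longrightarrow> q \<in> W \<Longrightarrow> (\<Sum>j\<in>Basis. a j q * b (E j) (E i) q) = \<xi> (E i) q"
proof -
  note E = local_frame_vector_field[OF frame]
  have p_M: "p \<in> topspace M" using openin_subset[OF local_frame_openin[OF frame]] p by blast
  obtain d a where d: "smooth_at d p" "d p \<noteq> 0" and a: "\<And>j. j \<in> Basis \<Longrightarrow> smooth_at (a j) p"
    and solves: "\<And>i. i \<in> Basis \<Longrightarrow> (\<Sum>j\<in>Basis. b (E j) (E i) * a j) = d * \<xi> (E i)"
  proof (rule linear_system_solvable_at[OF unital_subring_smooth_at[OF p_M], of Basis "\<lambda>i j. b (E j) (E i)"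
        "\<lambda>i. \<xi> (E i)" p])
    show "b (E j) (E i) \<in> {f. smooth_at f p}" if "i \<in> Basis" "j \<in> Basis" for i j
      using smooth_function_smooth_at[OF form_C[OF E E] p_M] that by simp
    show "\<xi> (E i) \<in> {f. smooth_at f p}" if "i \<in> Basis" for i
      using smooth_function_smooth_at[OF one_form_C[OF \<xi> E] p_M] that by simp
    show "v j = 0" if "\<And>i. i \<in> Basis \<Longrightarrow> (\<Sum>k\<in>Basis. b (E k) (E i) p * v k) = 0" "j \<in> Basis" for v j
      by (rule gram_injective[OF frame p that])
  qed auto
  obtain W where W: "openin M W" "p \<in> W" and d_nz: "\<And>q. q \<in> W \<Longrightarrow> d q \<noteq> 0"
    by (rule smooth_at_nonzero_nearby[OF d]) blast
  obtain h W' where h: "\<And>j. j \<in> Basis \<Longrightarrow> h j \<in> C" and W': "openin M W'" "p \<in> W'"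
    and h_eq: "\<And>j q. j \<in> Basis \<Longrightarrow> q \<in> W' \<Longrightarrow> h j q = a j q * inverse (d q)"
    using smooth_at_extends_finite[OF finite_Basis p_M, of "\<lambda>j q. a j q * inverse (d q)"]
      smooth_at_mult[OF a smooth_at_inverse[OF d]] by (auto simp: times_fun_def)
  show ?thesis
  proof (rule that[OF h openin_Int[OF W(1) W'(1)]])
    fix i :: 'e and q assume i: "i \<in> Basis" and q: "q \<in> W \<inter> W'"
    have "(\<Sum>j\<in>Basis. h j q * b (E j) (E i) q) = inverse (d q) * (\<Sum>j\<in>Basis. b (E j) (E i) * a j) q"
      using q by (simp add: h_eq sum_fun_apply sum_distrib_left mult_ac)
    also have "\<dots> = \<xi> (E i) q" using q d_nz by (simp add: solves[OF i])
    finally show "(\<Sum>j\<in>Basis. h j q * b (E j) (E i) q) = \<xi> (E i) q" .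
  qed (use W(2) W'(2) in simp_all)
qed

lemma riesz_local:
  assumes \<xi>: "\<xi> \<in> \<Omega>" and p: "p \<in> topspace M"
  obtains W X where "openin M W" "p \<in> W" "X \<in> \<X>" "\<And>Y q. Y \<in> \<X> \<Longrightarrow> q \<in> W \<Longrightarrow> b X Y q = \<xi> Y q"
proof -
  obtain N E x where p_N: "p \<in> N" and frame: "local_frame N E x"
    by (rule local_frame_exists[OF p])
  note E = local_frame_vector_field[OF frame]
  obtain a W where a: "\<And>j. j \<in> Basis \<Longrightarrow> a j \<in> C" and W: "openin M W" "p \<in> W"
    and solves: "\<And>i q. i \<in> Basis \<Longrightarrow> q \<in> W \<Longrightarrow> (\<Sum>j\<in>Basis. a j q * b (E j) (E i) q) = \<xi> (E i) q"
    by (rule gram_system_solvable[OF frame p_N \<xi>]) blast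
  define X where "X = (\<Sum>j\<in>Basis. a j \<cdot>\<^sub>F E j)"
  have X: "X \<in> \<X>" unfolding X_def by (intro vfield_sum vfield_fmult a E)
  have XE: "b X (E i) q = \<xi> (E i) q" if i: "i \<in> Basis" and q: "q \<in> W" for i q
  proof -
    have "b X (E i) = (\<Sum>j\<in>Basis. a j * b (E j) (E i))"
      unfolding X_def by (rule C_linear_sum[OF form_C_linear_left[OF E[OF i]] a E])
    then show ?thesis using solves[OF i q] by (simp add: sum_fun_apply)
  qed
  show ?thesis
  proof (rule that[OF openin_Int[OF local_frame_openin[OF frame] W(1)] _ X])
    show "b X Y q = \<xi> Y q" if Y: "Y \<in> \<X>" and q: "q \<in> N \<inter> W" for Y q
      using q C_linear_frame_expansion[OF frame form_C_linear_right[OF X] Y, of q]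
        C_linear_frame_expansion[OF frame one_form_C_linear[OF \<xi>] Y, of q] by (simp add: XE)
  qed (use p_N W(2) in blast)
qed

text \<open>By nondegeneracy the local solutions agree where they overlap, so they glue without a
  partition of unity.\<close>

lemma riesz:
  assumes \<xi>: "\<xi> \<in> \<Omega>"
  obtains X where "X \<in> \<X>" "\<And>Y. Y \<in> \<X> \<Longrightarrow> b X Y = \<xi> Y"
proof -
  have "\<exists>N L. openin M N \<and> p \<in> N \<and> L \<in> \<X> \<and> (\<forall>Y\<in>\<X>. \<forall>q\<in>N. b L Y q = \<xi> Y q)"
    if "p \<in> topspace M" for p
    by (rule riesz_local[OF \<xi> that]) blast
  then obtain N L where N: "\<And>p. p \<in> topspace M \<Longrightarrow> openin M (N p)" "\<And>p. p \<in> topspace M \<Longrightarrow> p \<in> N p"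
    and L: "\<And>p. p \<in> topspace M \<Longrightarrow> L p \<in> \<X>"
    and solves: "\<And>p Y q. p \<in> topspace M \<Longrightarrow> Y \<in> \<X> \<Longrightarrow> q \<in> N p \<Longrightarrow> b (L p) Y q = \<xi> Y q"
    by metis
  have compatible: "L q f q = L p f q" if "f \<in> C" "p \<in> topspace M" "q \<in> N p" for f p q
  proof -
    have q: "q \<in> topspace M" using openin_subset[OF N(1)] that(2,3) by blast
    show ?thesis
      by (rule vfield_eq_at[OF L[OF q] L[OF that(2)] q _ that(1)])
        (simp add: solves[OF q _ N(2)[OF q]] solves[OF that(2) _ that(3)])
  qed
  obtain X where X: "X \<in> \<X>" and X_L: "\<And>f p q. f \<in> C \<Longrightarrow> p \<in> topspace M \<Longrightarrow> q \<in> N p \<Longrightarrow> X f q = L p f q"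
    by (rule vfield_glue[of N L]) (use N L compatible in blast)+
  have "b X Y = \<xi> Y" if Y: "Y \<in> \<X>" for Y
  proof
    show "b X Y p = \<xi> Y p" for p
    proof (cases "p \<in> topspace M")
      case True
      have "b X Y p = b (L p) Y p"
        by (rule C_linear_local[OF form_C_linear_left[OF Y] X L[OF True] N[OF True] X_L[OF _ True]])
      then show ?thesis using solves[OF True Y N(2)[OF True]] by simp
    next
      case False
      then show ?thesis
        using smooth_function_outside[OF form_C[OF X Y]]
          smooth_function_outside[OF one_form_C[OF \<xi> Y]] by metis
    qed
  qed
  with X show ?thesis by (rule that)
qed

lemma flat_apply: "Y \<in> \<X> \<Longrightarrow> flat M A b X Y = b X Y"
  by (simp add: flat_def)

lemma flat_one_form:
  assumes "X \<in> \<X>"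
  shows "flat M A b X \<in> \<Omega>"
proof (rule one_formI)
  show "C_linear (flat M A b X)"
    using form_C_linear_right[OF assms] by (simp add: C_linear_def flat_apply vfield_add vfield_fmult)
qed (use assms in \<open>simp_all add: flat_def form_C\<close>)

lemma bij_betw_flat: "bij_betw (flat M A b) \<X> \<Omega>"
proof (rule bij_betw_imageI)
  show "inj_on (flat M A b) \<X>"
    by (intro inj_onI vfield_eqI) (simp_all flip: flat_apply)
  show "flat M A b ` \<X> = \<Omega>"
  proof (intro equalityI subsetI)
    fix \<xi> assume \<xi>: "\<xi> \<in> \<Omega>"
    obtain X where X: "X \<in> \<X>" "\<And>Y. Y \<in> \<X> \<Longrightarrow> b X Y = \<xi> Y"
      by (rule riesz[OF \<xi>]) blast
    have "flat M A b X = \<xi>" using X(2) one_form_outside[OF \<xi>] by (auto simp: flat_def)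
    with X(1) show "\<xi> \<in> flat M A b ` \<X>" by blast
  qed (use flat_one_form in blast)
qed

lemma sharp_vector_field: "\<xi> \<in> \<Omega> \<Longrightarrow> sharp M A b \<xi> \<in> \<X>"
  unfolding sharp_def by (rule bij_betwE[OF bij_betw_inv_into[OF bij_betw_flat], rule_format])

lemma flat_sharp: "\<xi> \<in> \<Omega> \<Longrightarrow> flat M A b (sharp M A b \<xi>) = \<xi>"
  unfolding sharp_def by (rule bij_betw_inv_into_right[OF bij_betw_flat])

lemma sharp_flat: "X \<in> \<X> \<Longrightarrow> sharp M A b (flat M A b X) = X"
  unfolding sharp_def by (rule bij_betw_inv_into_left[OF bij_betw_flat])

lemma sharp_eqI: "X \<in> \<X> \<Longrightarrow> flat M A b X = \<xi> \<Longrightarrow> sharp M A b \<xi> = X"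
  using sharp_flat by blast

end

section \<open>Endomorphisms of the generalized tangent bundle\<close>

lemma fmult_add: "f \<cdot>\<^sub>F (S + T) = f \<cdot>\<^sub>F S + f \<cdot>\<^sub>F T"
  by (simp add: fmult_def fun_eq_iff algebra_simps)

lemma fmult_uminus: "f \<cdot>\<^sub>F (- T) = - (f \<cdot>\<^sub>F T)"
  by (simp add: fmult_def fun_eq_iff)

lemma fmult_left_commute: "f \<cdot>\<^sub>F h \<cdot>\<^sub>F T = h \<cdot>\<^sub>F f \<cdot>\<^sub>F T"
  by (simp add: fmult_def mult.left_commute)

context manifold
begin

lemma one_form_add:
  assumes "\<xi> \<in> \<Omega>" "\<eta> \<in> \<Omega>"
  shows "\<xi> + \<eta> \<in> \<Omega>"
  using assms unfolding one_forms_def by (auto simp: C_add algebra_simps)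

lemma one_form_fmult_closed:
  assumes "\<xi> \<in> \<Omega>" "\<And>h. h \<in> C \<Longrightarrow> f * h \<in> C"
  shows "f \<cdot>\<^sub>F \<xi> \<in> \<Omega>"
  using assms unfolding one_forms_def fmult_def by (auto simp: distrib_left mult.left_commute)

lemma one_form_fmult: "f \<in> C \<Longrightarrow> \<xi> \<in> \<Omega> \<Longrightarrow> f \<cdot>\<^sub>F \<xi> \<in> \<Omega>"
  by (rule one_form_fmult_closed) (auto intro: C_mult)

lemma one_form_scale: "\<xi> \<in> \<Omega> \<Longrightarrow> (\<lambda>_. a) \<cdot>\<^sub>F \<xi> \<in> \<Omega>"
  by (rule one_form_fmult_closed) (auto intro: C_scale)

lemma one_form_uminus:
  assumes "\<xi> \<in> \<Omega>"
  shows "- \<xi> \<in> \<Omega>"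
proof -
  have "- \<xi> = (\<lambda>_. - 1) \<cdot>\<^sub>F \<xi>" by (simp add: fmult_def fun_eq_iff)
  then show ?thesis using one_form_scale[OF assms] by simp
qed

lemma one_form_zero: "0 \<in> \<Omega>"
  by (simp add: one_forms_def C_zero)

abbreviation "\<Gamma> \<equiv> gsections M A"

lemma gsection_zero: "0 \<in> \<Gamma>"
  by (simp add: gsections_def zero_prod_def vfield_zero one_form_zero)

lemma gsection_uminus: "s \<in> \<Gamma> \<Longrightarrow> - s \<in> \<Gamma>"
  by (auto simp: gsections_def vfield_uminus one_form_uminus)

lemma gen_endomorphism_closed: "gen_endomorphism M A T \<Longrightarrow> s \<in> \<Gamma> \<Longrightarrow> T s \<in> \<Gamma>"
  by (simp add: gen_endomorphism_def)

lemma gen_endomorphism_uminus: "gen_endomorphism M A T \<Longrightarrow> s \<in> \<Gamma> \<Longrightarrow> T (- s) = - T s"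
  by (rule additive_uminus[where S = \<Gamma>]) (simp_all add: gen_endomorphism_def gsection_zero gsection_uminus)

lemma gen_endomorphism_compose:
  assumes P: "gen_endomorphism M A P" and Q: "gen_endomorphism M A Q"
    and R: "\<And>s. s \<in> \<Gamma> \<Longrightarrow> R s = P (Q s)"
  shows "gen_endomorphism M A R"
proof -
  have "s + t \<in> \<Gamma>" if "s \<in> \<Gamma>" "t \<in> \<Gamma>" for s t
    using that by (auto simp: gsections_def vfield_add one_form_add)
  moreover have "(f \<cdot>\<^sub>F fst s, f \<cdot>\<^sub>F snd s) \<in> \<Gamma>" if "f \<in> C" "s \<in> \<Gamma>" for f s
    using that by (auto simp: gsections_def vfield_fmult one_form_fmult)
  ultimately show ?thesis
    using P Q by (simp add: gen_endomorphism_def R)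
qed

subsection \<open>Recognising the three types of triple structures\<close>

context
  fixes P Q R :: "'a gsection \<Rightarrow> 'a gsection"
  assumes P: "gen_endomorphism M A P" and Q: "gen_endomorphism M A Q"
    and R: "\<And>s. s \<in> \<Gamma> \<Longrightarrow> R s = P (Q s)"
begin

lemmas triple_simps = gen_eq_def R gen_endomorphism_closed[OF P] gen_endomorphism_closed[OF Q]
  gen_endomorphism_uminus[OF P] gen_endomorphism_uminus[OF Q]

lemma generalized_triple_structureI:
  assumes "gen_eq M A (P \<circ> P) id \<or> gen_eq M A (P \<circ> P) (- id)"
    and "gen_eq M A (Q \<circ> Q) id \<or> gen_eq M A (Q \<circ> Q) (- id)"
    and "gen_eq M A (R \<circ> R) id \<or> gen_eq M A (R \<circ> R) (- id)"
    and "gen_eq M A (Q \<circ> P) (P \<circ> Q) \<or> gen_eq M A (Q \<circ> P) (- (P \<circ> Q))"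
  shows "generalized_triple_structure M A P Q R"
  using assms P Q gen_endomorphism_compose[OF P Q R]
  by (simp add: generalized_triple_structure_def gen_eq_def R)

lemma generalized_almost_hyperproductI:
  assumes "\<And>s. s \<in> \<Gamma> \<Longrightarrow> P (P s) = s" "\<And>s. s \<in> \<Gamma> \<Longrightarrow> Q (Q s) = s" "\<And>s. s \<in> \<Gamma> \<Longrightarrow> Q (P s) = P (Q s)"
  shows "generalized_almost_hyperproduct M A P Q R"
  unfolding generalized_almost_hyperproduct_def pairwise_commute_def
  by (intro conjI generalized_triple_structureI disjI1) (simp_all add: triple_simps assms)

lemma generalized_almost_biparacomplexI:
  assumes "\<And>s. s \<in> \<Gamma> \<Longrightarrow> P (P s) = s" "\<And>s. s \<in> \<Gamma> \<Longrightarrow> Q (Q s) = s" "\<And>s. s \<in> \<Gamma> \<Longrightarrow> Q (P s) = - P (Q s)"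
  shows "generalized_almost_biparacomplex M A P Q R"
proof -
  have "gen_eq M A (P \<circ> P) id" "gen_eq M A (Q \<circ> Q) id" "gen_eq M A (R \<circ> R) (- id)"
    "gen_eq M A (Q \<circ> P) (- (P \<circ> Q))" "pairwise_anticommute M A P Q R"
    by (simp_all add: pairwise_anticommute_def triple_simps assms)
  then show ?thesis
    unfolding generalized_almost_biparacomplex_def by (simp add: generalized_triple_structureI)
qed

lemma generalized_almost_bicomplexI:
  assumes "\<And>s. s \<in> \<Gamma> \<Longrightarrow> P (P s) = - s" "\<And>s. s \<in> \<Gamma> \<Longrightarrow> Q (Q s) = - s" "\<And>s. s \<in> \<Gamma> \<Longrightarrow> Q (P s) = P (Q s)"
  shows "generalized_almost_bicomplex M A P Q R"
proof -
  have "gen_eq M A (P \<circ> P) (- id)" "gen_eq M A (Q \<circ> Q) (- id)" "gen_eq M A (R \<circ> R) id"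
    "gen_eq M A (Q \<circ> P) (P \<circ> Q)" "pairwise_commute M A P Q R"
    by (simp_all add: pairwise_commute_def triple_simps assms)
  then show ?thesis
    unfolding generalized_almost_bicomplex_def by (simp add: generalized_triple_structureI)
qed

end

subsection \<open>Diagonal operators\<close>

context
  fixes F :: "'a vfield \<Rightarrow> 'a vfield"
  assumes F: "vfield_endomorphism M A F"
begin

lemma dual_map_one_form:
  assumes \<xi>: "\<xi> \<in> \<Omega>"
  shows "dual_map M A F \<xi> \<in> \<Omega>"
proof (rule one_formI)
  show "C_linear (dual_map M A F \<xi>)"
    using one_form_C_linear[OF \<xi>] F
    by (simp add: C_linear_def dual_map_def vfield_endomorphism_def vfield_add vfield_fmult)
qed (use F in \<open>simp_all add: dual_map_def vfield_endomorphism_def one_form_C[OF \<xi>]\<close>)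

lemma gen_diag_endomorphism: "gen_endomorphism M A (gen_diag M A l F)"
proof -
  have "dual_map M A F (\<xi> + \<eta>) = dual_map M A F \<xi> + dual_map M A F \<eta>" for \<xi> \<eta>
    by (auto simp: dual_map_def)
  moreover have "dual_map M A F (f \<cdot>\<^sub>F \<xi>) = f \<cdot>\<^sub>F dual_map M A F \<xi>" for f \<xi>
    by (auto simp: dual_map_def fmult_def)
  ultimately show ?thesis
    using F unfolding gen_endomorphism_def gsections_def gen_diag_def block_def
    by (auto simp: vfield_endomorphism_def dual_map_one_form one_form_scale fmult_add fmult_left_commute)
qed

lemma gen_diag_involution:
  assumes involution: "\<And>X. X \<in> \<X> \<Longrightarrow> F (F X) = X" and l: "l * l = 1" and s: "s \<in> \<Gamma>"
  shows "gen_diag M A l F (gen_diag M A l F s) = s"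
proof -
  obtain X \<xi> where s_eq: "s = (X, \<xi>)" and X: "X \<in> \<X>" and \<xi>: "\<xi> \<in> \<Omega>"
    using s by (auto simp: gsections_def)
  have "(\<lambda>_. l) * ((\<lambda>_. l) * f) = f" for f :: "'a sfun"
    using l by (auto simp flip: mult.assoc)
  then have "(\<lambda>_. l) \<cdot>\<^sub>F dual_map M A F ((\<lambda>_. l) \<cdot>\<^sub>F dual_map M A F \<xi>) = \<xi>"
    using F involution one_form_outside[OF \<xi>] by (auto simp: dual_map_def fmult_def vfield_endomorphism_def)
  then show ?thesis by (simp add: s_eq gen_diag_def block_def involution[OF X])
qed

end

end

subsection \<open>Off-diagonal operators\<close>

context nondegenerate_form
begin

lemma flat_add: "X \<in> \<X> \<Longrightarrow> Y \<in> \<X> \<Longrightarrow> flat M A b (X + Y) = flat M A b X + flat M A b Y"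
  using bilinear by (auto simp: flat_def bilinear_form_def)

lemma flat_fmult: "f \<in> C \<Longrightarrow> X \<in> \<X> \<Longrightarrow> flat M A b (f \<cdot>\<^sub>F X) = f \<cdot>\<^sub>F flat M A b X"
  using bilinear by (auto simp: flat_def bilinear_form_def fmult_def)

lemma flat_uminus: "X \<in> \<X> \<Longrightarrow> flat M A b (- X) = - flat M A b X"
  by (rule additive_uminus[where S = \<X>]) (blast intro: flat_add vfield_zero vfield_uminus)+

lemma sharp_add: "\<xi> \<in> \<Omega> \<Longrightarrow> \<eta> \<in> \<Omega> \<Longrightarrow> sharp M A b (\<xi> + \<eta>) = sharp M A b \<xi> + sharp M A b \<eta>"
  by (rule sharp_eqI) (simp_all add: flat_add flat_sharp vfield_add sharp_vector_field)

lemma sharp_fmult: "f \<in> C \<Longrightarrow> \<xi> \<in> \<Omega> \<Longrightarrow> sharp M A b (f \<cdot>\<^sub>F \<xi>) = f \<cdot>\<^sub>F sharp M A b \<xi>"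
  by (rule sharp_eqI) (simp_all add: flat_fmult flat_sharp vfield_fmult sharp_vector_field)

lemma sharp_uminus: "\<xi> \<in> \<Omega> \<Longrightarrow> sharp M A b (- \<xi>) = - sharp M A b \<xi>"
  by (rule sharp_eqI) (simp_all add: flat_uminus flat_sharp vfield_uminus sharp_vector_field)

lemma gen_F_apply: "gen_F M A b (X, \<xi>) = (sharp M A b \<xi>, flat M A b X)"
  and gen_J_apply: "gen_J M A b (X, \<xi>) = (- sharp M A b \<xi>, flat M A b X)"
  by (simp_all add: gen_F_def gen_J_def block_def)

lemma gen_F_endomorphism: "gen_endomorphism M A (gen_F M A b)"
  unfolding gen_endomorphism_def gsections_def
  by (auto simp: gen_F_apply flat_one_form sharp_vector_field flat_add sharp_add flat_fmult sharp_fmult)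

lemma gen_J_endomorphism: "gen_endomorphism M A (gen_J M A b)"
  unfolding gen_endomorphism_def gsections_def
  by (auto simp: gen_J_apply flat_one_form sharp_vector_field vfield_uminus flat_add sharp_add
      flat_fmult sharp_fmult fmult_uminus)

lemma gen_F_involution: "s \<in> \<Gamma> \<Longrightarrow> gen_F M A b (gen_F M A b s) = s"
  by (auto simp: gsections_def gen_F_apply flat_sharp sharp_flat)

lemma gen_J_anti_involution: "s \<in> \<Gamma> \<Longrightarrow> gen_J M A b (gen_J M A b s) = - s"
  by (auto simp: gsections_def gen_J_apply flat_uminus sharp_vector_field flat_sharp sharp_flat)

end

section \<open>The triple structures of a metric manifold with \<open>F\<^sup>2 = Id\<close>\<close>

locale product_metric_manifold = manifold M A
  for M :: "'a topology" and A :: "('a, 'e::euclidean_space) chart set" +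
  fixes F :: "'a vfield \<Rightarrow> 'a vfield" and g :: "'a vfield \<Rightarrow> 'a vfield \<Rightarrow> 'a sfun" and \<epsilon> :: real
  assumes metric: "metric_manifold 1 \<epsilon> M A F g"
begin

abbreviation "\<phi> \<equiv> fundamental_tensor F g"

lemma \<epsilon>_square: "\<epsilon> * \<epsilon> = 1"
  and metric_bilinear: "bilinear_form M A g"
  and metric_nondegenerate: "nondegenerate M A g"
  and F_endomorphism: "vfield_endomorphism M A F"
  and F_isometry: "X \<in> \<X> \<Longrightarrow> Y \<in> \<X> \<Longrightarrow> g (F X) (F Y) = (\<lambda>_. \<epsilon>) * g X Y"
  using metric by (auto simp: metric_manifold_def pseudo_riemannian_metric_def)

lemma F_involution: "X \<in> \<X> \<Longrightarrow> F (F X) = X"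
  using metric by (simp add: metric_manifold_def fmult_def fun_eq_iff)

lemma F_closed: "X \<in> \<X> \<Longrightarrow> F X \<in> \<X>"
  and F_add: "X \<in> \<X> \<Longrightarrow> Y \<in> \<X> \<Longrightarrow> F (X + Y) = F X + F Y"
  using F_endomorphism by (simp_all add: vfield_endomorphism_def)

lemma F_uminus: "X \<in> \<X> \<Longrightarrow> F (- X) = - F X"
  by (rule additive_uminus[where S = \<X>]) (blast intro: F_add vfield_zero vfield_uminus)+

lemma F_adjoint:
  assumes "X \<in> \<X>" "Y \<in> \<X>"
  shows "g (F X) Y = (\<lambda>_. \<epsilon>) * g X (F Y)"
  using F_isometry[OF assms(1) F_closed[OF assms(2)]] by (simp add: F_involution assms(2))

lemma fundamental_tensor_bilinear: "bilinear_form M A \<phi>"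
  using metric_bilinear F_endomorphism
  by (simp add: bilinear_form_def vfield_endomorphism_def fundamental_tensor_def)

lemma fundamental_tensor_nondegenerate: "nondegenerate M A \<phi>"
  unfolding nondegenerate_def
proof (intro ballI impI)
  fix p X f
  assume p: "p \<in> topspace M" and X: "X \<in> \<X>" and f: "f \<in> C" and ker: "\<forall>Y\<in>\<X>. \<phi> X Y p = 0"
  have "g X Y p = 0" if Y: "Y \<in> \<X>" for Y
  proof -
    have "\<epsilon> * g X Y p = \<phi> X (F Y) p"
      using F_isometry[OF X Y] by (simp add: fundamental_tensor_def)
    also have "\<dots> = 0" using ker F_closed[OF Y] by blast
    finally show ?thesis using \<epsilon>_square by auto
  qed
  then show "X f p = 0" using metric_nondegenerate p X f unfolding nondegenerate_def by blast
qed

sublocale g: nondegenerate_form M A g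
  by unfold_locales (rule metric_bilinear metric_nondegenerate)+

sublocale \<phi>: nondegenerate_form M A \<phi>
  by unfold_locales (rule fundamental_tensor_bilinear fundamental_tensor_nondegenerate)+

abbreviation flat_metric (\<open>\<flat>\<close>) where "\<flat> \<equiv> flat M A g"
abbreviation sharp_metric (\<open>\<sharp>\<close>) where "\<sharp> \<equiv> sharp M A g"

lemma flat_fundamental_tensor: "flat M A \<phi> X = \<flat> (F X)"
  by (simp add: flat_def fundamental_tensor_def)

lemma sharp_fundamental_tensor: "\<xi> \<in> \<Omega> \<Longrightarrow> sharp M A \<phi> \<xi> = F (\<sharp> \<xi>)"
  by (rule \<phi>.sharp_eqI)
    (simp_all add: flat_fundamental_tensor F_closed F_involution g.sharp_vector_field g.flat_sharp)

lemma dual_map_conjugate: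
  assumes "\<xi> \<in> \<Omega>"
  shows "(\<lambda>_. \<epsilon>) \<cdot>\<^sub>F dual_map M A F \<xi> = \<flat> (F (\<sharp> \<xi>))"
proof
  fix Y
  have \<xi>: "\<xi> Z = g (\<sharp> \<xi>) Z" if "Z \<in> \<X>" for Z
    using g.flat_apply[OF that, of "\<sharp> \<xi>"] by (simp add: g.flat_sharp assms)
  show "((\<lambda>_. \<epsilon>) \<cdot>\<^sub>F dual_map M A F \<xi>) Y = \<flat> (F (\<sharp> \<xi>)) Y"
    by (cases "Y \<in> \<X>")
      (simp_all add: fmult_def dual_map_def flat_def \<xi> F_closed F_adjoint g.sharp_vector_field assms)
qed

lemma gen_F_fundamental_tensor: "\<xi> \<in> \<Omega> \<Longrightarrow> gen_F M A \<phi> (X, \<xi>) = (F (\<sharp> \<xi>), \<flat> (F X))"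
  and gen_J_fundamental_tensor: "\<xi> \<in> \<Omega> \<Longrightarrow> gen_J M A \<phi> (X, \<xi>) = (- F (\<sharp> \<xi>), \<flat> (F X))"
  by (simp_all add: \<phi>.gen_F_apply \<phi>.gen_J_apply flat_fundamental_tensor sharp_fundamental_tensor)

lemma gen_diag_apply: "\<xi> \<in> \<Omega> \<Longrightarrow> gen_diag M A \<epsilon> F (X, \<xi>) = (F X, \<flat> (F (\<sharp> \<xi>)))"
  by (simp add: gen_diag_def block_def dual_map_conjugate)

lemma gen_diag_uminus_apply:
  assumes "\<xi> \<in> \<Omega>"
  shows "gen_diag M A (- \<epsilon>) F (X, \<xi>) = (F X, - \<flat> (F (\<sharp> \<xi>)))"
proof -
  have "(\<lambda>_. - \<epsilon>) \<cdot>\<^sub>F dual_map M A F \<xi> = - ((\<lambda>_. \<epsilon>) \<cdot>\<^sub>F dual_map M A F \<xi>)"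
    by (simp add: fmult_def fun_eq_iff)
  then show ?thesis by (simp add: gen_diag_def block_def dual_map_conjugate assms)
qed

lemmas operator_simps = g.gen_F_apply g.gen_J_apply gen_F_fundamental_tensor gen_J_fundamental_tensor
  gen_diag_apply gen_diag_uminus_apply
  F_closed g.flat_one_form g.sharp_vector_field vfield_uminus one_form_uminus
  F_involution g.flat_sharp g.sharp_flat F_uminus g.flat_uminus g.sharp_uminus

lemma hyperproduct_F_g_diag_F_\<phi>:
  "generalized_almost_hyperproduct M A (gen_F M A g) (gen_diag M A \<epsilon> F) (gen_F M A \<phi>)"
proof (rule generalized_almost_hyperproductI[OF g.gen_F_endomorphism
      gen_diag_endomorphism[OF F_endomorphism]])
  fix s assume s: "s \<in> \<Gamma>"
  show "gen_F M A \<phi> s = gen_F M A g (gen_diag M A \<epsilon> F s)"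
    "gen_diag M A \<epsilon> F (gen_F M A g s) = gen_F M A g (gen_diag M A \<epsilon> F s)"
    using s by (auto simp: gsections_def operator_simps)
  show "gen_F M A g (gen_F M A g s) = s" by (rule g.gen_F_involution[OF s])
  show "gen_diag M A \<epsilon> F (gen_diag M A \<epsilon> F s) = s"
    by (rule gen_diag_involution[OF F_endomorphism F_involution \<epsilon>_square s])
qed

lemma biparacomplex_F_g_diag_J_\<phi>:
  "generalized_almost_biparacomplex M A (gen_F M A g) (gen_diag M A (- \<epsilon>) F) (gen_J M A \<phi>)"
proof (rule generalized_almost_biparacomplexI[OF g.gen_F_endomorphism
      gen_diag_endomorphism[OF F_endomorphism]])
  fix s assume s: "s \<in> \<Gamma>"
  show "gen_J M A \<phi> s = gen_F M A g (gen_diag M A (- \<epsilon>) F s)"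
    "gen_diag M A (- \<epsilon>) F (gen_F M A g s) = - gen_F M A g (gen_diag M A (- \<epsilon>) F s)"
    using s by (auto simp: gsections_def operator_simps)
  show "gen_F M A g (gen_F M A g s) = s" by (rule g.gen_F_involution[OF s])
  show "gen_diag M A (- \<epsilon>) F (gen_diag M A (- \<epsilon>) F s) = s"
    by (rule gen_diag_involution[OF F_endomorphism F_involution _ s]) (simp_all add: \<epsilon>_square)
qed

lemma biparacomplex_F_\<phi>_diag_J_g:
  "generalized_almost_biparacomplex M A (gen_F M A \<phi>) (gen_diag M A (- \<epsilon>) F) (gen_J M A g)"
proof (rule generalized_almost_biparacomplexI[OF \<phi>.gen_F_endomorphism
      gen_diag_endomorphism[OF F_endomorphism]])
  fix s assume s: "s \<in> \<Gamma>"
  show "gen_J M A g s = gen_F M A \<phi> (gen_diag M A (- \<epsilon>) F s)"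
    "gen_diag M A (- \<epsilon>) F (gen_F M A \<phi> s) = - gen_F M A \<phi> (gen_diag M A (- \<epsilon>) F s)"
    using s by (auto simp: gsections_def operator_simps)
  show "gen_F M A \<phi> (gen_F M A \<phi> s) = s" by (rule \<phi>.gen_F_involution[OF s])
  show "gen_diag M A (- \<epsilon>) F (gen_diag M A (- \<epsilon>) F s) = s"
    by (rule gen_diag_involution[OF F_endomorphism F_involution _ s]) (simp_all add: \<epsilon>_square)
qed

lemma bicomplex_J_g_J_\<phi>_diag:
  "generalized_almost_bicomplex M A (gen_J M A g) (gen_J M A \<phi>) (- gen_diag M A \<epsilon> F)"
proof (rule generalized_almost_bicomplexI[OF g.gen_J_endomorphism \<phi>.gen_J_endomorphism])
  fix s assume s: "s \<in> \<Gamma>"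
  show "(- gen_diag M A \<epsilon> F) s = gen_J M A g (gen_J M A \<phi> s)"
    "gen_J M A \<phi> (gen_J M A g s) = gen_J M A g (gen_J M A \<phi> s)"
    using s by (auto simp: gsections_def operator_simps)
  show "gen_J M A g (gen_J M A g s) = - s" by (rule g.gen_J_anti_involution[OF s])
  show "gen_J M A \<phi> (gen_J M A \<phi> s) = - s" by (rule \<phi>.gen_J_anti_involution[OF s])
qed

end

theorem proposition5p8:
  fixes M :: "'a topology"
    and A :: "('a, 'e::euclidean_space) chart set"
    and F :: "'a vfield \<Rightarrow> 'a vfield"
    and g \<phi> :: "'a vfield \<Rightarrow> 'a vfield \<Rightarrow> 'a sfun"
    and \<alpha> \<epsilon> :: real
  assumes "metric_manifold \<alpha> \<epsilon> M A F g"
    and "\<alpha> = 1"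
    and "\<phi> = fundamental_tensor F g"
  shows "generalized_almost_hyperproduct M A (gen_F M A g) (gen_diag M A \<epsilon> F) (gen_F M A \<phi>) \<and>
         generalized_almost_biparacomplex M A (gen_F M A g) (gen_diag M A (- \<epsilon>) F) (gen_J M A \<phi>) \<and>
         generalized_almost_biparacomplex M A (gen_F M A \<phi>) (gen_diag M A (- \<epsilon>) F) (gen_J M A g) \<and>
         generalized_almost_bicomplex M A (gen_J M A g) (gen_J M A \<phi>) (- gen_diag M A \<epsilon> F)"
proof -
  interpret product_metric_manifold M A F g \<epsilon>
    using assms(1,2) by unfold_locales (simp_all add: metric_manifold_def)
  show ?thesis
    unfolding assms(3)
    by (intro conjI hyperproduct_F_g_diag_F_\<phi> biparacomplex_F_g_diag_J_\<phi> biparacomplex_F_\<phi>_diag_J_g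
        bicomplex_J_g_J_\<phi>_diag)
qed

end
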